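(* Let $\mathcal{A}$ be an AB4-category, $X$ a cubical set, and $F:(\Box/X)^{op}\to\mathcal{A}$ a local system on $X$. For $n\ge0$ let $X^N_n\subseteq X_n$ be the set of non-degenerate $n$-dimensional cubes of $X$. Then the objects $C^N_n(X,F)$ of the normalized complex are isomorphic to $\bigoplus_{x\in X^N_n}F(x)$, and (under these isomorphisms) the differentials $d^N_n:\bigoplus_{x\in X^N_n}F(x)\to\bigoplus_{x\in X^N_{n-1}}F(x)$ are the morphisms making the following square commute: $$d^N_n\circ pr_n=pr_{n-1}\circ d_n,$$ where $pr_n:\bigoplus_{x\in X_n}F(x)\to\bigoplus_{x\in X^N_n}F(x)$ is the projection onto the direct summand and $d_n=\sum_{i=1}^n(-1)^i(d^{n,0}_i-d^{n,1}_i):\bigoplus_{x\in X_n}F(x)\to\bigoplus_{x\in X_{n-1}}F(x)$.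
   Context: **AB4-category.** An Abelian category with all small coproducts in which coproducts are exact (Grothendieck's axioms AB3, AB4). **Cube category.** $\Box$ has objects $\mathbb{I}^n=\{0,1\}^n$, $n\ge 0$ (with the product order); its morphisms are all compositions of the maps $\delta_i^{k,\varepsilon}:\mathbb{I}^{k-1}\to\mathbb{I}^k$, $\delta_i^{k,\varepsilon}(x_1,\dots,x_{k-1})=(x_1,\dots,x_{i-1},\varepsilon,x_i,\dots,x_{k-1})$ and $\sigma_i^k:\mathbb{I}^k\to\mathbb{I}^{k-1}$, $\sigma^k_i(x_1,\dots,x_k)=(x_1,\dots,x_{i-1},x_{i+1},\dots,x_k)$ ($k\ge1$, $1\le i\le k$, $\varepsilon\in\{0,1\}$) (and identities). A cubical set is a functor $X:\Box^{op}\to\mathrm{Set}$, $X_n=X(\mathbb{I}^n)$. A cube $x\in X_n$ is degenerate if $x=X(\sigma^n_i)(y)$ for some $1\le i\le n$ and $y\in X_{n-1}$; otherwise it is non-degenerate. **Category $\Box/X$, local systems.** $\Box/X$ has as objects the elements $x\in\coprod_n X_n$. For $y\in X_m$, $x\in X_n$, morphisms $y\to x$ are the $\alpha\in\Box(\mathbb{I}^m,\mathbb{I}^n)$ with $X(\alpha)(x)=y$. So $F:(\Box/X)^{op}\to\mathcal{A}$ gives morphisms $F(\alpha):F(x)\to F(X(\alpha)x)$. $F$ is a local system if all morphisms $F(\alpha)$ are isomorphisms. **Normalized complex $C^N_*(X,F)$.** Put $C_n(X,F)=\bigoplus_{x\in X_n}F(x)$ with injections $in_x$. Define $d_i^{n,\varepsilon}:C_n(X,F)\to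 C_{n-1}(X,F)$ by $d_i^{n,\varepsilon}\circ in_x=in_{X(\delta_i^{n,\varepsilon})x}\circ F(\delta_i^{n,\varepsilon})$, and $s_i^n:C_{n-1}(X,F)\to C_n(X,F)$ by $s_i^n\circ in_x=in_{X(\sigma_i^n)x}\circ F(\sigma_i^n)$. Then $C^{N}_n(X,F)=\mathrm{Coker}\big((s_1^n,\dots,s_n^n):C_{n-1}(X,F)^{\oplus n}\to C_n(X,F)\big)$, with differentials induced by $d_n=\sum_{i=1}^n(-1)^i(d_i^{n,0}-d_i^{n,1})$. *)

theory Defs
  imports "HOL-Algebra.Ring" "HOL-Library.FuncSet"
begin

record ('o, 'm) cat =
  Obj :: "'o set"
  Arr :: "'m set"
  Dom :: "'m \<Rightarrow> 'o"
  Cod :: "'m \<Rightarrow> 'o"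
  Idn :: "'o \<Rightarrow> 'm"
  Comp :: "'m \<Rightarrow> 'm \<Rightarrow> 'm" (infixl "\<bullet>\<index>" 70)

definition Hom :: "('o, 'm, 'z) cat_scheme \<Rightarrow> 'o \<Rightarrow> 'o \<Rightarrow> 'm set" where
  "Hom C a b = {f \<in> Arr C. Dom C f = a \<and> Cod C f = b}"

locale category =
  fixes C :: "('o, 'm, 'z) cat_scheme" (structure)
  assumes Dom_Obj: "f \<in> Arr C \<Longrightarrow> Dom C f \<in> Obj C"
    and Cod_Obj: "f \<in> Arr C \<Longrightarrow> Cod C f \<in> Obj C"
    and Idn_Hom: "a \<in> Obj C \<Longrightarrow> Idn C a \<in> Hom C a a"
    and Comp_Hom: "f \<in> Hom C a b \<Longrightarrow> g \<in> Hom C b c \<Longrightarrow> g \<bullet> f \<in> Hom C a c"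
    and Comp_Idn: "f \<in> Hom C a b \<Longrightarrow> f \<bullet> Idn C a = f"
    and Idn_Comp: "f \<in> Hom C a b \<Longrightarrow> Idn C b \<bullet> f = f"
    and Comp_assoc: "f \<in> Hom C a b \<Longrightarrow> g \<in> Hom C b c \<Longrightarrow> h \<in> Hom C c d \<Longrightarrow>
      h \<bullet> (g \<bullet> f) = (h \<bullet> g) \<bullet> f"

definition Op :: "('o, 'm, 'z) cat_scheme \<Rightarrow> ('o, 'm) cat" where
  "Op C = \<lparr>Obj = Obj C, Arr = Arr C, Dom = Cod C, Cod = Dom C, Idn = Idn C,
           Comp = (\<lambda>g f. Comp C f g)\<rparr>"

definition is_isomorphism :: "('o, 'm, 'z) cat_scheme \<Rightarrow> 'o \<Rightarrow> 'o \<Rightarrow> 'm \<Rightarrow> bool" where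
  "is_isomorphism C a b f \<longleftrightarrow> f \<in> Hom C a b \<and>
     (\<exists>g\<in>Hom C b a. Comp C g f = Idn C a \<and> Comp C f g = Idn C b)"

definition is_mono :: "('o, 'm, 'z) cat_scheme \<Rightarrow> 'm \<Rightarrow> bool" where
  "is_mono C f \<longleftrightarrow> f \<in> Arr C \<and>
     (\<forall>c. \<forall>g\<in>Hom C c (Dom C f). \<forall>h\<in>Hom C c (Dom C f). Comp C f g = Comp C f h \<longrightarrow> g = h)"

definition is_epi :: "('o, 'm, 'z) cat_scheme \<Rightarrow> 'm \<Rightarrow> bool" where
  "is_epi C f \<longleftrightarrow> f \<in> Arr C \<and>
     (\<forall>c. \<forall>g\<in>Hom C (Cod C f) c. \<forall>h\<in>Hom C (Cod C f) c. Comp C g f = Comp C h f \<longrightarrow> g = h)"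

record ('o, 'm, 'p, 'q) functr =
  OMap :: "'o \<Rightarrow> 'p"
  AMap :: "'m \<Rightarrow> 'q"

definition is_functor ::
  "('o, 'm, 'y) cat_scheme \<Rightarrow> ('p, 'q, 'z) cat_scheme \<Rightarrow> ('o, 'm, 'p, 'q) functr \<Rightarrow> bool" where
  "is_functor C D F \<longleftrightarrow>
     (\<forall>a\<in>Obj C. OMap F a \<in> Obj D \<and> AMap F (Idn C a) = Idn D (OMap F a)) \<and>
     (\<forall>f\<in>Arr C. AMap F f \<in> Hom D (OMap F (Dom C f)) (OMap F (Cod C f))) \<and>
     (\<forall>f\<in>Arr C. \<forall>g\<in>Arr C. Dom C g = Cod C f \<longrightarrow>
        AMap F (Comp C g f) = Comp D (AMap F g) (AMap F f))"

text \<open>Sets with elements in \<^typ>\<open>'x\<close>; the arrow \<open>(S, f, T)\<close> is the map \<open>f\<close> from \<open>S\<close> to \<open>T\<close>,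
  where \<open>f\<close> is made \<^const>\<open>undefined\<close> off \<open>S\<close> so that equality of arrows is equality of maps.\<close>

definition SetCat :: "('x set, 'x set \<times> ('x \<Rightarrow> 'x) \<times> 'x set) cat" where
  "SetCat = \<lparr>Obj = UNIV,
     Arr = {(S, f, T). f \<in> S \<rightarrow>\<^sub>E T},
     Dom = fst,
     Cod = (\<lambda>\<alpha>. snd (snd \<alpha>)),
     Idn = (\<lambda>S. (S, \<lambda>x\<in>S. x, S)),
     Comp = (\<lambda>\<beta> \<alpha>. (fst \<alpha>, compose (fst \<alpha>) (fst (snd \<beta>)) (fst (snd \<alpha>)), snd (snd \<beta>)))\<rparr>"

record ('o, 'm) preadd = "('o, 'm) cat" +
  Add :: "'m \<Rightarrow> 'm \<Rightarrow> 'm"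
  Zer :: "'o \<Rightarrow> 'o \<Rightarrow> 'm"

text \<open>Only the additive part of the ring record is meaningful here; it gives access to the
  additive notation and the finite sums of the library.\<close>

definition HomGrp :: "('o, 'm, 'z) preadd_scheme \<Rightarrow> 'o \<Rightarrow> 'o \<Rightarrow> 'm ring" where
  "HomGrp C a b = \<lparr>carrier = Hom C a b, monoid.mult = undefined, one = undefined,
     zero = Zer C a b, add = Add C\<rparr>"

locale preadditive_category = category C
  for C :: "('o, 'm, 'z) preadd_scheme" (structure) +
  assumes HomGrp: "a \<in> Obj C \<Longrightarrow> b \<in> Obj C \<Longrightarrow> abelian_group (HomGrp C a b)"
    and Comp_Add: "f \<in> Hom C a b \<Longrightarrow> f' \<in> Hom C a b \<Longrightarrow> g \<in> Hom C b c \<Longrightarrow>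
      g \<bullet> (Add C f f') = Add C (g \<bullet> f) (g \<bullet> f')"
    and Add_Comp: "f \<in> Hom C a b \<Longrightarrow> g \<in> Hom C b c \<Longrightarrow> g' \<in> Hom C b c \<Longrightarrow>
      (Add C g g') \<bullet> f = Add C (g \<bullet> f) (g' \<bullet> f)"

definition is_zero_obj :: "('o, 'm, 'z) cat_scheme \<Rightarrow> 'o \<Rightarrow> bool" where
  "is_zero_obj C z \<longleftrightarrow> z \<in> Obj C \<and>
     (\<forall>a\<in>Obj C. (\<exists>!f. f \<in> Hom C a z) \<and> (\<exists>!f. f \<in> Hom C z a))"

definition is_biproduct ::
  "('o, 'm, 'z) preadd_scheme \<Rightarrow> 'o \<Rightarrow> 'o \<Rightarrow> 'o \<Rightarrow> 'm \<Rightarrow> 'm \<Rightarrow> 'm \<Rightarrow> 'm \<Rightarrow> bool" where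
  "is_biproduct C a b c i\<^sub>1 i\<^sub>2 p\<^sub>1 p\<^sub>2 \<longleftrightarrow>
     c \<in> Obj C \<and> i\<^sub>1 \<in> Hom C a c \<and> i\<^sub>2 \<in> Hom C b c \<and> p\<^sub>1 \<in> Hom C c a \<and> p\<^sub>2 \<in> Hom C c b \<and>
     Comp C p\<^sub>1 i\<^sub>1 = Idn C a \<and> Comp C p\<^sub>2 i\<^sub>2 = Idn C b \<and>
     Comp C p\<^sub>1 i\<^sub>2 = Zer C b a \<and> Comp C p\<^sub>2 i\<^sub>1 = Zer C a b \<and>
     Add C (Comp C i\<^sub>1 p\<^sub>1) (Comp C i\<^sub>2 p\<^sub>2) = Idn C c"

definition is_kernel :: "('o, 'm, 'z) preadd_scheme \<Rightarrow> 'm \<Rightarrow> 'm \<Rightarrow> bool" where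
  "is_kernel C g k \<longleftrightarrow> g \<in> Arr C \<and> k \<in> Arr C \<and> Cod C k = Dom C g \<and>
     Comp C g k = Zer C (Dom C k) (Cod C g) \<and>
     (\<forall>a. \<forall>f\<in>Hom C a (Dom C g). Comp C g f = Zer C a (Cod C g) \<longrightarrow>
        (\<exists>!h. h \<in> Hom C a (Dom C k) \<and> Comp C k h = f))"

definition is_cokernel :: "('o, 'm, 'z) preadd_scheme \<Rightarrow> 'm \<Rightarrow> 'm \<Rightarrow> bool" where
  "is_cokernel C g q \<longleftrightarrow> g \<in> Arr C \<and> q \<in> Arr C \<and> Dom C q = Cod C g \<and>
     Comp C q g = Zer C (Dom C g) (Cod C q) \<and>
     (\<forall>b. \<forall>f\<in>Hom C (Cod C g) b. Comp C f g = Zer C (Dom C g) b \<longrightarrow>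
        (\<exists>!h. h \<in> Hom C (Cod C q) b \<and> Comp C h q = f))"

locale abelian_category = preadditive_category C
  for C :: "('o, 'm, 'z) preadd_scheme" (structure) +
  assumes zero_object: "\<exists>z. is_zero_obj C z"
    and biproducts: "a \<in> Obj C \<Longrightarrow> b \<in> Obj C \<Longrightarrow> \<exists>c i\<^sub>1 i\<^sub>2 p\<^sub>1 p\<^sub>2. is_biproduct C a b c i\<^sub>1 i\<^sub>2 p\<^sub>1 p\<^sub>2"
    and kernels: "f \<in> Arr C \<Longrightarrow> \<exists>k. is_kernel C f k"
    and cokernels: "f \<in> Arr C \<Longrightarrow> \<exists>q. is_cokernel C f q"
    and normal_mono: "is_mono C f \<Longrightarrow> \<exists>g. is_kernel C g f"
    and normal_epi: "is_epi C f \<Longrightarrow> \<exists>g. is_cokernel C g f"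

text \<open>The sequence \<open>0 \<rightarrow> a \<rightarrow> b \<rightarrow> c \<rightarrow> 0\<close> with maps \<open>f\<close>, \<open>g\<close> is exact.\<close>

definition short_exact :: "('o, 'm, 'z) preadd_scheme \<Rightarrow> 'm \<Rightarrow> 'm \<Rightarrow> bool" where
  "short_exact C f g \<longleftrightarrow> is_kernel C g f \<and> is_cokernel C f g"

definition is_coproduct ::
  "('o, 'm, 'z) cat_scheme \<Rightarrow> 'i set \<Rightarrow> ('i \<Rightarrow> 'o) \<Rightarrow> 'o \<Rightarrow> ('i \<Rightarrow> 'm) \<Rightarrow> bool" where
  "is_coproduct C I B c u \<longleftrightarrow> c \<in> Obj C \<and> (\<forall>i\<in>I. u i \<in> Hom C (B i) c) \<and>
     (\<forall>b\<in>Obj C. \<forall>f. (\<forall>i\<in>I. f i \<in> Hom C (B i) b) \<longrightarrow>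
        (\<exists>!h. h \<in> Hom C c b \<and> (\<forall>i\<in>I. Comp C h (u i) = f i)))"

text \<open>The small sets are rendered as the sets with elements in a type \<^typ>\<open>'i\<close>, which
  is passed as a parameter: coproducts are indexed by arbitrary subsets of \<^typ>\<open>'i\<close>. Objects and
  arrows may live in larger types.\<close>

locale ab4_category = abelian_category C
  for C :: "('o, 'm, 'z) preadd_scheme" (structure) +
  fixes index :: "'i itself"
  assumes coproducts:
    "\<And>(I :: 'i set) B. B \<in> I \<rightarrow> Obj C \<Longrightarrow> \<exists>c u. is_coproduct C I B c u"
    and coproducts_exact:
    "\<And>(I :: 'i set) B B' B'' f g b b' b'' u u' u'' h k.
       \<lbrakk> \<forall>i\<in>I. f i \<in> Hom C (B' i) (B i) \<and> g i \<in> Hom C (B i) (B'' i) \<and> short_exact C (f i) (g i);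
         is_coproduct C I B' b' u'; is_coproduct C I B b u; is_coproduct C I B'' b'' u'';
         h \<in> Hom C b' b; \<forall>i\<in>I. h \<bullet> u' i = u i \<bullet> f i;
         k \<in> Hom C b b''; \<forall>i\<in>I. k \<bullet> u i = u'' i \<bullet> g i \<rbrakk>
       \<Longrightarrow> short_exact C h k"

text \<open>Coproducts and cokernels are only unique up to isomorphism; an arbitrary choice is fixed
  for each diagram.\<close>

definition coprod :: "('o, 'm, 'z) cat_scheme \<Rightarrow> 'i set \<Rightarrow> ('i \<Rightarrow> 'o) \<Rightarrow> 'o" where
  "coprod C I B = fst (SOME p. is_coproduct C I B (fst p) (snd p))"

definition coprod_in :: "('o, 'm, 'z) cat_scheme \<Rightarrow> 'i set \<Rightarrow> ('i \<Rightarrow> 'o) \<Rightarrow> 'i \<Rightarrow> 'm" where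
  "coprod_in C I B = snd (SOME p. is_coproduct C I B (fst p) (snd p))"

definition copair ::
  "('o, 'm, 'z) cat_scheme \<Rightarrow> 'i set \<Rightarrow> ('i \<Rightarrow> 'o) \<Rightarrow> 'o \<Rightarrow> ('i \<Rightarrow> 'm) \<Rightarrow> 'm" where
  "copair C I B b f =
     (THE h. h \<in> Hom C (coprod C I B) b \<and> (\<forall>i\<in>I. Comp C h (coprod_in C I B i) = f i))"

definition coker :: "('o, 'm, 'z) preadd_scheme \<Rightarrow> 'm \<Rightarrow> 'm" where
  "coker C f = (SOME q. is_cokernel C f q)"

definition cube :: "nat \<Rightarrow> bool list set" where
  "cube n = {xs. length xs = n}"

text \<open>The object \<open>n\<close> of the cube category stands for \<^term>\<open>cube n\<close>; an arrow \<open>(m, f, n)\<close> is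
  a map from \<^term>\<open>cube m\<close> to \<^term>\<open>cube n\<close>, again \<^const>\<open>undefined\<close> off \<^term>\<open>cube m\<close>.\<close>

type_synonym box_arrow = "nat \<times> (bool list \<Rightarrow> bool list) \<times> nat"

definition box_idn :: "nat \<Rightarrow> box_arrow" where
  "box_idn n = (n, \<lambda>xs\<in>cube n. xs, n)"

definition box_comp :: "box_arrow \<Rightarrow> box_arrow \<Rightarrow> box_arrow" where
  "box_comp \<beta> \<alpha> =
     (fst \<alpha>, compose (cube (fst \<alpha>)) (fst (snd \<beta>)) (fst (snd \<alpha>)), snd (snd \<beta>))"

definition face :: "nat \<Rightarrow> nat \<Rightarrow> bool \<Rightarrow> box_arrow" where
  "face k i \<epsilon> = (k - 1, \<lambda>xs\<in>cube (k - 1). take (i - 1) xs @ \<epsilon> # drop (i - 1) xs, k)"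

definition degen :: "nat \<Rightarrow> nat \<Rightarrow> box_arrow" where
  "degen k i = (k, \<lambda>xs\<in>cube k. take (i - 1) xs @ drop i xs, k - 1)"

inductive_set box_arrows :: "box_arrow set" where
  idn: "box_idn n \<in> box_arrows"
| face: "1 \<le> i \<Longrightarrow> i \<le> k \<Longrightarrow> face k i \<epsilon> \<in> box_arrows"
| degen: "1 \<le> i \<Longrightarrow> i \<le> k \<Longrightarrow> degen k i \<in> box_arrows"
| comp: "\<alpha> \<in> box_arrows \<Longrightarrow> \<beta> \<in> box_arrows \<Longrightarrow> fst \<beta> = snd (snd \<alpha>) \<Longrightarrow>
    box_comp \<beta> \<alpha> \<in> box_arrows"

definition Box :: "(nat, box_arrow) cat" where
  "Box = \<lparr>Obj = UNIV, Arr = box_arrows, Dom = fst, Cod = (\<lambda>\<alpha>. snd (snd \<alpha>)),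
          Idn = box_idn, Comp = box_comp\<rparr>"

type_synonym 'x cubical =
  "(nat, box_arrow, 'x set, 'x set \<times> ('x \<Rightarrow> 'x) \<times> 'x set) functr"

definition cubical_set :: "'x cubical \<Rightarrow> bool" where
  "cubical_set X \<longleftrightarrow> is_functor (Op Box) SetCat X"

abbreviation cubes :: "'x cubical \<Rightarrow> nat \<Rightarrow> 'x set" where
  "cubes X n \<equiv> OMap X n"

definition act :: "'x cubical \<Rightarrow> box_arrow \<Rightarrow> 'x \<Rightarrow> 'x" where
  "act X \<alpha> = fst (snd (AMap X \<alpha>))"

definition degenerate :: "'x cubical \<Rightarrow> nat \<Rightarrow> 'x \<Rightarrow> bool" where
  "degenerate X n x \<longleftrightarrow> (\<exists>i\<in>{1..n}. \<exists>y\<in>cubes X (n - 1). x = act X (degen n i) y)"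

definition nondeg :: "'x cubical \<Rightarrow> nat \<Rightarrow> 'x set" where
  "nondeg X n = {x \<in> cubes X n. \<not> degenerate X n x}"

text \<open>A cube is tagged with its dimension, because the sets of cubes of different dimensions need
  not be disjoint. An arrow is stored with its source and target: \<open>(y, \<alpha>, x)\<close>.\<close>

type_synonym 'x el_arrow = "(nat \<times> 'x) \<times> box_arrow \<times> (nat \<times> 'x)"

definition Cubes :: "'x cubical \<Rightarrow> (nat \<times> 'x, 'x el_arrow) cat" where
  "Cubes X = \<lparr>Obj = {(n, x). x \<in> cubes X n},
     Arr = {((m, y), \<alpha>, (n, x)) | m y \<alpha> n x.
              y \<in> cubes X m \<and> x \<in> cubes X n \<and> \<alpha> \<in> Hom Box m n \<and> act X \<alpha> x = y},
     Dom = fst,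
     Cod = (\<lambda>a. snd (snd a)),
     Idn = (\<lambda>p. (p, Idn Box (fst p), p)),
     Comp = (\<lambda>b a. (fst a, Comp Box (fst (snd b)) (fst (snd a)), snd (snd b)))\<rparr>"

type_synonym ('x, 'o, 'm) coeff = "(nat \<times> 'x, 'x el_arrow, 'o, 'm) functr"

definition local_system ::
  "('o, 'm, 'z) preadd_scheme \<Rightarrow> 'x cubical \<Rightarrow> ('x, 'o, 'm) coeff \<Rightarrow> bool" where
  "local_system A X F \<longleftrightarrow> is_functor (Op (Cubes X)) A F \<and>
     (\<forall>a\<in>Arr (Cubes X). is_isomorphism A (OMap F (Cod (Cubes X) a)) (OMap F (Dom (Cubes X) a)) (AMap F a))"

text \<open>\<open>F(\<alpha>) : F(x) \<rightarrow> F(X(\<alpha>)x)\<close> for a cube \<open>x\<close> of dimension the codomain of \<open>\<alpha>\<close>.\<close>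

definition coeff_map :: "'x cubical \<Rightarrow> ('x, 'o, 'm) coeff \<Rightarrow> box_arrow \<Rightarrow> 'x \<Rightarrow> 'm" where
  "coeff_map X F \<alpha> x = AMap F ((Dom Box \<alpha>, act X \<alpha> x), \<alpha>, (Cod Box \<alpha>, x))"

context
  fixes A :: "('o, 'm, 'z) preadd_scheme" and X :: "'x cubical" and F :: "('x, 'o, 'm) coeff"
begin

definition chain :: "nat \<Rightarrow> 'o" where
  "chain n = coprod A (cubes X n) (\<lambda>x. OMap F (n, x))"

definition chain_in :: "nat \<Rightarrow> 'x \<Rightarrow> 'm" where
  "chain_in n = coprod_in A (cubes X n) (\<lambda>x. OMap F (n, x))"

definition chain_face :: "nat \<Rightarrow> nat \<Rightarrow> bool \<Rightarrow> 'm" where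
  "chain_face n i \<epsilon> = copair A (cubes X n) (\<lambda>x. OMap F (n, x)) (chain (n - 1))
     (\<lambda>x. Comp A (chain_in (n - 1) (act X (face n i \<epsilon>) x)) (coeff_map X F (face n i \<epsilon>) x))"

definition chain_degen :: "nat \<Rightarrow> nat \<Rightarrow> 'm" where
  "chain_degen n i = copair A (cubes X (n - 1)) (\<lambda>x. OMap F (n - 1, x)) (chain n)
     (\<lambda>x. Comp A (chain_in n (act X (degen n i) x)) (coeff_map X F (degen n i) x))"

text \<open>\<open>False\<close> and \<open>True\<close> are the vertices 0 and 1.\<close>

definition chain_diff :: "nat \<Rightarrow> 'm" where
  "chain_diff n = (let G = HomGrp A (chain n) (chain (n - 1)) in
     \<Oplus>\<^bsub>G\<^esub>i\<in>{1..n}. [((-1 :: int) ^ i)] \<cdot>\<^bsub>G\<^esub> (chain_face n i False \<ominus>\<^bsub>G\<^esub> chain_face n i True))"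

text \<open>\<open>(s\<^sub>1, \<dots>, s\<^sub>n) : C\<^sub>n\<^sub>-\<^sub>1 \<oplus> \<dots> \<oplus> C\<^sub>n\<^sub>-\<^sub>1 \<rightarrow> C\<^sub>n\<close>; for \<open>n = 0\<close> the source is the empty
  coproduct, that is, a zero object.\<close>

definition degen_total :: "nat \<Rightarrow> 'm" where
  "degen_total n = copair A {1..n} (\<lambda>_. chain (n - 1)) (chain n) (chain_degen n)"

definition norm_quot :: "nat \<Rightarrow> 'm" where
  "norm_quot n = coker A (degen_total n)"

definition norm_chain :: "nat \<Rightarrow> 'o" where
  "norm_chain n = Cod A (norm_quot n)"

definition norm_diff :: "nat \<Rightarrow> 'm" where
  "norm_diff n = (THE h. h \<in> Hom A (norm_chain n) (norm_chain (n - 1)) \<and>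
     Comp A h (norm_quot n) = Comp A (norm_quot (n - 1)) (chain_diff n))"

definition nondeg_chain :: "nat \<Rightarrow> 'o" where
  "nondeg_chain n = coprod A (nondeg X n) (\<lambda>x. OMap F (n, x))"

definition nondeg_proj :: "nat \<Rightarrow> 'm" where
  "nondeg_proj n = copair A (cubes X n) (\<lambda>x. OMap F (n, x)) (nondeg_chain n)
     (\<lambda>x. if x \<in> nondeg X n then coprod_in A (nondeg X n) (\<lambda>x. OMap F (n, x)) x
          else Zer A (OMap F (n, x)) (nondeg_chain n))"

end

end

theory Submission
  imports Defs "HOL-Algebra.AbelCoset"
begin

text \<open>A morphism \<open>f\<close> out of \<open>C\<^sub>n(X,F)\<close> kills all images of the \<open>s\<^sub>i\<close> iff it kills the summands
  \<open>F(x)\<close> of the degenerate cubes \<open>x\<close>: the restriction of \<open>f \<circ> s\<^sub>i\<close> to \<open>F(y)\<close> is the restriction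
  of \<open>f\<close> to the summand of \<open>X(\<sigma>\<^sub>i)y\<close> composed with the isomorphism \<open>F(\<sigma>\<^sub>i)\<close>. Hence the
  projection \<open>pr\<^sub>n\<close> is itself a cokernel of \<open>(s\<^sub>1, \<dots>, s\<^sub>n)\<close>. The cubical identities show
  that \<open>pr\<^sub>n\<^sub>-\<^sub>1 \<circ> d\<^sub>n\<close> kills the degenerate summands: for \<open>x = X(\<sigma>\<^sub>j)y\<close> the two faces in direction
  \<open>j\<close> cancel and all other faces are degenerate.\<close>

section \<open>Categories, coproducts and cokernels\<close>

text \<open>Each difference is sent to zero, hence so is any integer multiple of it. Applied to the
  differential, this reduces vanishing to agreement of opposite faces.\<close>

lemma (in abelian_group_hom) hom_signed_sum_zero:
  assumes "finite I" "x \<in> I \<rightarrow> carrier G" "y \<in> I \<rightarrow> carrier G"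
    and "\<And>i. i \<in> I \<Longrightarrow> h (x i) = h (y i)"
  shows "h (\<Oplus>\<^bsub>G\<^esub>i\<in>I. [(k i :: int)] \<cdot>\<^bsub>G\<^esub> (x i \<ominus>\<^bsub>G\<^esub> y i)) = \<zero>\<^bsub>H\<^esub>"
  using assms
proof (induction I rule: finite_induct)
  case empty
  then show ?case by simp
next
  case (insert j I)
  have mem: "(\<lambda>i. [(k i :: int)] \<cdot>\<^bsub>G\<^esub> (x i \<ominus>\<^bsub>G\<^esub> y i)) \<in> I \<rightarrow> carrier G"
    "[(k j :: int)] \<cdot>\<^bsub>G\<^esub> (x j \<ominus>\<^bsub>G\<^esub> y j) \<in> carrier G"
    using insert.prems by (auto simp: a_minus_def Pi_iff intro!: G.add.int_pow_closed)
  have "h (x j \<ominus>\<^bsub>G\<^esub> y j) = \<zero>\<^bsub>H\<^esub>"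
    using insert.prems by (simp add: a_minus_def H.r_neg)
  moreover have "h ([(k j :: int)] \<cdot>\<^bsub>G\<^esub> (x j \<ominus>\<^bsub>G\<^esub> y j)) = [k j] \<cdot>\<^bsub>H\<^esub> h (x j \<ominus>\<^bsub>G\<^esub> y j)"
    using group_hom.hom_int_pow[OF a_group_hom] insert.prems
    by (simp add: add_pow_def a_minus_def)
  ultimately have "h ([(k j :: int)] \<cdot>\<^bsub>G\<^esub> (x j \<ominus>\<^bsub>G\<^esub> y j)) = \<zero>\<^bsub>H\<^esub>"
    by (simp add: H.add.int_pow_one)
  then show ?case
    using insert mem by simp
qed

lemma carrier_HomGrp: "carrier (HomGrp C a b) = Hom C a b"
  by (simp add: HomGrp_def)

lemma (in category) Hom_Obj:
  assumes "f \<in> Hom C a b"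
  shows "a \<in> Obj C" "b \<in> Obj C"
  using assms Dom_Obj Cod_Obj by (auto simp: Hom_def)

text \<open>Compose with an inverse on the right. Through this cancellation the invertibility of the
  maps of a local system enters.\<close>

lemma (in category) isomorphism_right_cancel:
  assumes "is_isomorphism C a b f" "g \<in> Hom C b c" "h \<in> Hom C b c" "g \<bullet> f = h \<bullet> f"
  shows "g = h"
proof -
  obtain k where k: "f \<in> Hom C a b" "k \<in> Hom C b a" "f \<bullet> k = Idn C b"
    using assms(1) by (auto simp: is_isomorphism_def)
  have "g = (g \<bullet> f) \<bullet> k" "h = (h \<bullet> f) \<bullet> k"
    using k(3) Comp_assoc[OF k(2,1) assms(2)] Comp_assoc[OF k(2,1) assms(3)]
      Comp_Idn[OF assms(2)] Comp_Idn[OF assms(3)] by simp_all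
  with assms(4) show ?thesis by simp
qed

lemma coprod_is_coproduct:
  assumes "is_coproduct C I B c u"
  shows "is_coproduct C I B (coprod C I B) (coprod_in C I B)"
proof -
  have "\<exists>p. is_coproduct C I B (fst p) (snd p)"
    using assms by (metis fst_conv snd_conv)
  then show ?thesis
    unfolding coprod_def coprod_in_def by (rule someI_ex)
qed

lemma is_coproduct_in:
  assumes "is_coproduct C I B c u" "i \<in> I"
  shows "u i \<in> Hom C (B i) c"
  using assms by (simp add: is_coproduct_def)

lemma (in category) coproduct_hom_eqI:
  assumes "is_coproduct C I B c u" "g \<in> Hom C c b" "h \<in> Hom C c b"
    and "\<And>i. i \<in> I \<Longrightarrow> g \<bullet> u i = h \<bullet> u i"
  shows "g = h"
proof -
  have "b \<in> Obj C" "\<forall>i\<in>I. g \<bullet> u i \<in> Hom C (B i) b"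
    using assms Hom_Obj Comp_Hom by (auto simp: is_coproduct_def)
  then have "\<exists>!k. k \<in> Hom C c b \<and> (\<forall>i\<in>I. k \<bullet> u i = g \<bullet> u i)"
    using assms(1) by (simp add: is_coproduct_def)
  with assms show ?thesis by metis
qed

lemma (in category) copair:
  assumes "is_coproduct C I B c u" "b \<in> Obj C" "\<And>i. i \<in> I \<Longrightarrow> f i \<in> Hom C (B i) b"
  shows copair_Hom: "copair C I B b f \<in> Hom C (coprod C I B) b"
    and copair_in: "i \<in> I \<Longrightarrow> copair C I B b f \<bullet> coprod_in C I B i = f i"
proof -
  have "\<exists>!h. h \<in> Hom C (coprod C I B) b \<and> (\<forall>i\<in>I. h \<bullet> coprod_in C I B i = f i)"
    using coprod_is_coproduct[OF assms(1)] assms(2,3) by (simp add: is_coproduct_def)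
  from theI'[OF this]
  show "copair C I B b f \<in> Hom C (coprod C I B) b"
    and "i \<in> I \<Longrightarrow> copair C I B b f \<bullet> coprod_in C I B i = f i"
    by (auto simp: copair_def)
qed

section \<open>Zero morphisms, cokernels and biproducts\<close>

context preadditive_category
begin

lemma Add_Hom: "f \<in> Hom C a b \<Longrightarrow> g \<in> Hom C a b \<Longrightarrow> Add C f g \<in> Hom C a b"
  using abelian_monoid.a_closed[OF abelian_group.axioms(1)[OF HomGrp]] Hom_Obj
  by (fastforce simp: HomGrp_def)

lemma Zer_Hom: "a \<in> Obj C \<Longrightarrow> b \<in> Obj C \<Longrightarrow> Zer C a b \<in> Hom C a b"
  using abelian_monoid.zero_closed[OF abelian_group.axioms(1)[OF HomGrp]]
  by (fastforce simp: HomGrp_def)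

lemma Add_Zer:
  assumes "f \<in> Hom C a b"
  shows "Add C f (Zer C a b) = f" "Add C (Zer C a b) f = f"
  using abelian_monoid.r_zero[OF abelian_group.axioms(1)[OF HomGrp[of a b]], of f]
    abelian_monoid.l_zero[OF abelian_group.axioms(1)[OF HomGrp[of a b]], of f] Hom_Obj[OF assms] assms
  by (auto simp: HomGrp_def)

text \<open>Cancellation in the Hom group. The locale postulates only distributivity of composition;
  this turns it into the rules for composing with zero morphisms.\<close>

lemma Add_self_Zer:
  assumes "f \<in> Hom C a b" "Add C f f = f"
  shows "f = Zer C a b"
proof -
  interpret abelian_group "HomGrp C a b"
    using HomGrp Hom_Obj assms(1) by blast
  show ?thesis
    using add.l_cancel_one[of f f] assms by (simp add: HomGrp_def)
qed

lemma Comp_Zer: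
  assumes "g \<in> Hom C b c" "a \<in> Obj C"
  shows "g \<bullet> Zer C a b = Zer C a c"
proof (rule Add_self_Zer)
  have z: "Zer C a b \<in> Hom C a b"
    using Zer_Hom Hom_Obj assms by blast
  show "g \<bullet> Zer C a b \<in> Hom C a c"
    using z assms Comp_Hom by blast
  show "Add C (g \<bullet> Zer C a b) (g \<bullet> Zer C a b) = g \<bullet> Zer C a b"
    using Comp_Add[OF z z assms(1)] Add_Zer[OF z] by simp
qed

lemma Zer_Comp:
  assumes "f \<in> Hom C a b" "c \<in> Obj C"
  shows "Zer C b c \<bullet> f = Zer C a c"
proof (rule Add_self_Zer)
  have z: "Zer C b c \<in> Hom C b c"
    using Zer_Hom Hom_Obj assms by blast
  show "Zer C b c \<bullet> f \<in> Hom C a c"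
    using z assms Comp_Hom by blast
  show "Add C (Zer C b c \<bullet> f) (Zer C b c \<bullet> f) = Zer C b c \<bullet> f"
    using Add_Comp[OF assms(1) z z] Add_Zer[OF z] by simp
qed

text \<open>Composition is additive in both arguments. In the form of a group homomorphism this
  applies to the whole signed sum of the differential at once.\<close>

lemma sandwich_hom:
  assumes "p \<in> Hom C b c" "g \<in> Hom C a' a"
  shows "abelian_group_hom (HomGrp C a b) (HomGrp C a' c) (\<lambda>t. p \<bullet> t \<bullet> g)"
proof (rule abelian_group_homI)
  show "abelian_group (HomGrp C a b)" "abelian_group (HomGrp C a' c)"
    using HomGrp Hom_Obj assms by blast+
  show "group_hom (add_monoid (HomGrp C a b)) (add_monoid (HomGrp C a' c)) (\<lambda>t. p \<bullet> t \<bullet> g)"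
  proof (intro group_hom.intro group_hom_axioms.intro homI)
    show "group (add_monoid (HomGrp C a b))" "group (add_monoid (HomGrp C a' c))"
      using abelian_group.a_group HomGrp Hom_Obj assms by blast+
  next
    fix s t
    assume st: "s \<in> carrier (add_monoid (HomGrp C a b))" "t \<in> carrier (add_monoid (HomGrp C a b))"
    then have st': "s \<in> Hom C a b" "t \<in> Hom C a b" by (auto simp: HomGrp_def)
    show "p \<bullet> s \<bullet> g \<in> carrier (add_monoid (HomGrp C a' c))"
      using st' assms Comp_Hom by (auto simp: HomGrp_def)
    have "p \<bullet> s \<in> Hom C a c" "p \<bullet> t \<in> Hom C a c"
      using st' assms Comp_Hom by blast+
    then show "p \<bullet> (s \<otimes>\<^bsub>add_monoid (HomGrp C a b)\<^esub> t) \<bullet> g =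
        (p \<bullet> s \<bullet> g) \<otimes>\<^bsub>add_monoid (HomGrp C a' c)\<^esub> (p \<bullet> t \<bullet> g)"
      using Comp_Add[OF st' assms(1)] Add_Comp[OF assms(2)] by (simp add: HomGrp_def)
  qed
qed

text \<open>Each cokernel factors through the other, and uniqueness of factorizations makes the two
  composites identities. The triangle later identifies the quotient map with the projection.\<close>

lemma cokernel_isomorphism:
  assumes q: "is_cokernel C f q" and q': "is_cokernel C f q'"
  obtains \<phi> where "is_isomorphism C (Cod C q) (Cod C q') \<phi>" "\<phi> \<bullet> q = q'"
proof -
  have hom: "q \<in> Hom C (Cod C f) (Cod C q)" "q' \<in> Hom C (Cod C f) (Cod C q')"
    using q q' by (auto simp: is_cokernel_def Hom_def)
  have factor: "\<exists>!h. h \<in> Hom C (Cod C q) b \<and> h \<bullet> q = r"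
      "\<exists>!h. h \<in> Hom C (Cod C q') b \<and> h \<bullet> q' = r"
    if "r \<in> Hom C (Cod C f) b" "r \<bullet> f = Zer C (Dom C f) b" for r b
    using that q q' unfolding is_cokernel_def by blast+
  have zero: "q \<bullet> f = Zer C (Dom C f) (Cod C q)" "q' \<bullet> f = Zer C (Dom C f) (Cod C q')"
    using q q' by (auto simp: is_cokernel_def)
  obtain \<phi> where \<phi>: "\<phi> \<in> Hom C (Cod C q) (Cod C q')" "\<phi> \<bullet> q = q'"
    using factor(1)[OF hom(2) zero(2)] by blast
  obtain \<psi> where \<psi>: "\<psi> \<in> Hom C (Cod C q') (Cod C q)" "\<psi> \<bullet> q' = q"
    using factor(2)[OF hom(1) zero(1)] by blast
  have "\<psi> \<bullet> \<phi> \<in> Hom C (Cod C q) (Cod C q)" "\<phi> \<bullet> \<psi> \<in> Hom C (Cod C q') (Cod C q')"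
    using Comp_Hom \<phi> \<psi> by blast+
  moreover have "(\<psi> \<bullet> \<phi>) \<bullet> q = q" "(\<phi> \<bullet> \<psi>) \<bullet> q' = q'"
    using Comp_assoc[OF hom(1) \<phi>(1) \<psi>(1)] Comp_assoc[OF hom(2) \<psi>(1) \<phi>(1)] \<phi> \<psi> by auto
  moreover have "Idn C (Cod C q) \<in> Hom C (Cod C q) (Cod C q)" "Idn C (Cod C q) \<bullet> q = q"
    "Idn C (Cod C q') \<in> Hom C (Cod C q') (Cod C q')" "Idn C (Cod C q') \<bullet> q' = q'"
    using Idn_Hom Idn_Comp Hom_Obj hom by blast+
  ultimately have "\<psi> \<bullet> \<phi> = Idn C (Cod C q)" "\<phi> \<bullet> \<psi> = Idn C (Cod C q')"
    using factor(1)[OF hom(1) zero(1)] factor(2)[OF hom(2) zero(2)] by blast+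
  with \<phi> \<psi> that show ?thesis by (auto simp: is_isomorphism_def)
qed

text \<open>\<open>is_biproduct\<close> is equational, so the universal property of a coproduct has
  to be extracted from it. The witness is the row matrix with entries \<open>f\<close> and
  \<open>g\<close>.\<close>

lemma biproduct_copair:
  assumes bi: "is_biproduct C a b c i\<^sub>1 i\<^sub>2 p\<^sub>1 p\<^sub>2" and f: "f \<in> Hom C a d" and g: "g \<in> Hom C b d"
  shows "\<exists>h\<in>Hom C c d. h \<bullet> i\<^sub>1 = f \<and> h \<bullet> i\<^sub>2 = g"
proof -
  let ?h = "Add C (f \<bullet> p\<^sub>1) (g \<bullet> p\<^sub>2)"
  note d = bi[unfolded is_biproduct_def]
  have i: "i\<^sub>1 \<in> Hom C a c" "i\<^sub>2 \<in> Hom C b c" and p: "p\<^sub>1 \<in> Hom C c a" "p\<^sub>2 \<in> Hom C c b"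
    using d by auto
  have fp: "f \<bullet> p\<^sub>1 \<in> Hom C c d" "g \<bullet> p\<^sub>2 \<in> Hom C c d"
    using Comp_Hom p f g by blast+
  have "?h \<bullet> i\<^sub>1 = Add C (f \<bullet> (p\<^sub>1 \<bullet> i\<^sub>1)) (g \<bullet> (p\<^sub>2 \<bullet> i\<^sub>1))"
    using Add_Comp[OF i(1) fp] Comp_assoc[OF i(1) p(1) f] Comp_assoc[OF i(1) p(2) g] by simp
  also have "\<dots> = f"
    using d Comp_Idn[OF f] Comp_Zer[OF g] Hom_Obj[OF f] Add_Zer[OF f] by simp
  finally have h1: "?h \<bullet> i\<^sub>1 = f" .
  have "?h \<bullet> i\<^sub>2 = Add C (f \<bullet> (p\<^sub>1 \<bullet> i\<^sub>2)) (g \<bullet> (p\<^sub>2 \<bullet> i\<^sub>2))"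
    using Add_Comp[OF i(2) fp] Comp_assoc[OF i(2) p(1) f] Comp_assoc[OF i(2) p(2) g] by simp
  also have "\<dots> = g"
    using d Comp_Idn[OF g] Comp_Zer[OF f] Hom_Obj[OF g] Add_Zer[OF g] by simp
  finally show ?thesis
    using h1 Add_Hom[OF fp] by blast
qed

text \<open>Expanding the identity of \<open>c\<close> as the sum of
  \<open>i\<^sub>1 \<bullet> p\<^sub>1\<close> and \<open>i\<^sub>2 \<bullet> p\<^sub>2\<close>
  recovers a morphism out of \<open>c\<close> from its two restrictions.\<close>

lemma biproduct_hom_eqI:
  assumes bi: "is_biproduct C a b c i\<^sub>1 i\<^sub>2 p\<^sub>1 p\<^sub>2" and h: "h \<in> Hom C c d" "h' \<in> Hom C c d"
    and eq: "h \<bullet> i\<^sub>1 = h' \<bullet> i\<^sub>1" "h \<bullet> i\<^sub>2 = h' \<bullet> i\<^sub>2"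
  shows "h = h'"
proof -
  note d = bi[unfolded is_biproduct_def]
  have i: "i\<^sub>1 \<in> Hom C a c" "i\<^sub>2 \<in> Hom C b c" and p: "p\<^sub>1 \<in> Hom C c a" "p\<^sub>2 \<in> Hom C c b"
    using d by auto
  have ip: "i\<^sub>1 \<bullet> p\<^sub>1 \<in> Hom C c c" "i\<^sub>2 \<bullet> p\<^sub>2 \<in> Hom C c c"
    using Comp_Hom p i by blast+
  have split: "k = Add C (k \<bullet> i\<^sub>1 \<bullet> p\<^sub>1) (k \<bullet> i\<^sub>2 \<bullet> p\<^sub>2)" if k: "k \<in> Hom C c d" for k
    using Comp_Add[OF ip k] Comp_assoc[OF p(1) i(1) k] Comp_assoc[OF p(2) i(2) k] Comp_Idn[OF k] d
    by simp
  show ?thesis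
    using split[OF h(1)] split[OF h(2)] eq by simp
qed

end

text \<open>The coproducts of \<open>ab4_category\<close> are indexed by subsets of one fixed type,
  later the type of cubes, whereas \<open>degen_total\<close> lives on a coproduct over
  \<open>{1..n}\<close>. Finite coproducts over any type are therefore built from a zero object and
  biproducts.\<close>

lemma (in abelian_category) finite_coproducts:
  assumes "finite I" "B \<in> I \<rightarrow> Obj C"
  shows "\<exists>c u. is_coproduct C I B c u"
  using assms
proof (induction I rule: finite_induct)
  case empty
  obtain z where "is_zero_obj C z"
    using zero_object by blast
  then have "is_coproduct C {} B z u" for u
    by (auto simp: is_zero_obj_def is_coproduct_def)
  then show ?case by blast
next
  case (insert j I)
  then obtain c u where cu: "is_coproduct C I B c u" by auto
  then have "c \<in> Obj C" "B j \<in> Obj C"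
    using insert by (auto simp: is_coproduct_def)
  then obtain d i\<^sub>1 i\<^sub>2 p\<^sub>1 p\<^sub>2 where bi: "is_biproduct C (B j) c d i\<^sub>1 i\<^sub>2 p\<^sub>1 p\<^sub>2"
    using biproducts by blast
  then have i: "i\<^sub>1 \<in> Hom C (B j) d" "i\<^sub>2 \<in> Hom C c d"
    by (auto simp: is_biproduct_def)
  \<comment> \<open>The new summand enters by \<open>i\<^sub>1\<close>; an old one enters the
    inductive coproduct \<open>c\<close> and then passes through \<open>i\<^sub>2\<close>.\<close>
  let ?v = "\<lambda>i. if i = j then i\<^sub>1 else i\<^sub>2 \<bullet> u i"
  have v: "?v i = i\<^sub>2 \<bullet> u i" if "i \<in> I" for i
    using that insert.hyps by auto
  have "is_coproduct C (insert j I) B d ?v"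
    unfolding is_coproduct_def
  proof (intro conjI ballI allI impI)
    show "d \<in> Obj C" using Hom_Obj i by blast
  next
    fix i assume "i \<in> insert j I"
    then show "?v i \<in> Hom C (B i) d"
      using i Comp_Hom[OF is_coproduct_in[OF cu] i(2)] by auto
  next
    fix b f assume b: "b \<in> Obj C" and f: "\<forall>i\<in>insert j I. f i \<in> Hom C (B i) b"
    then obtain g where g: "g \<in> Hom C c b" "\<And>i. i \<in> I \<Longrightarrow> g \<bullet> u i = f i"
      using cu unfolding is_coproduct_def by (metis insertCI)
    obtain h where h: "h \<in> Hom C d b" "h \<bullet> i\<^sub>1 = f j" "h \<bullet> i\<^sub>2 = g"
      using biproduct_copair[OF bi _ g(1)] f by blast
    show "\<exists>!h. h \<in> Hom C d b \<and> (\<forall>i\<in>insert j I. h \<bullet> ?v i = f i)"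
    proof (intro ex1I[of _ h] conjI ballI)
      show "h \<in> Hom C d b" by (rule h)
    next
      fix i assume i': "i \<in> insert j I"
      show "h \<bullet> ?v i = f i"
      proof (cases "i = j")
        case False
        with i' have "i \<in> I" by simp
        with v h g Comp_assoc[OF is_coproduct_in[OF cu] i(2) h(1)] show ?thesis by simp
      qed (simp add: h)
    next
      fix h' assume h': "h' \<in> Hom C d b \<and> (\<forall>i\<in>insert j I. h' \<bullet> ?v i = f i)"
      then have H: "h' \<in> Hom C d b" by blast
      have "h' \<bullet> i\<^sub>2 = g"
      proof (rule coproduct_hom_eqI[OF cu])
        show "h' \<bullet> i\<^sub>2 \<in> Hom C c b" using Comp_Hom i H by blast
        show "g \<in> Hom C c b" by (rule g)
        fix i assume i': "i \<in> I"
        have "h' \<bullet> ?v i = f i" using h' i' by blast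
        then show "h' \<bullet> i\<^sub>2 \<bullet> u i = g \<bullet> u i"
          using v[OF i'] g(2)[OF i'] Comp_assoc[OF is_coproduct_in[OF cu i'] i(2) H] by simp
      qed
      moreover have "h' \<bullet> i\<^sub>1 = f j"
        using h' by auto
      ultimately show "h' = h"
        using biproduct_hom_eqI[OF bi H h(1)] h by simp
    qed
  qed
  then show ?case by blast
qed

section \<open>Cubical identities\<close>

text \<open>Zero-based list form of a cubical identity: an entry inserted at or before position
  \<open>b\<close> pushes the entry to be removed from \<open>b\<close> to
  \<open>Suc b\<close>.\<close>

lemma remove_insert_less:
  "a \<le> b \<Longrightarrow> b < length xs \<Longrightarrow>
    take (Suc b) (take a xs @ e # drop a xs) @ drop (Suc (Suc b)) (take a xs @ e # drop a xs) =
    take a (take b xs @ drop (Suc b) xs) @ e # drop a (take b xs @ drop (Suc b) xs)"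
proof (induction xs arbitrary: a b)
  case (Cons x xs)
  then show ?case by (cases a; cases b) auto
qed simp

text \<open>The mirror case: the removed entry lies before the inserted one, so removing it first
  lowers the insertion position from \<open>Suc a\<close> to \<open>a\<close>.\<close>

lemma remove_insert_greater:
  "b \<le> a \<Longrightarrow> a < length xs \<Longrightarrow>
    take b (take (Suc a) xs @ e # drop (Suc a) xs) @ drop (Suc b) (take (Suc a) xs @ e # drop (Suc a) xs) =
    take a (take b xs @ drop (Suc b) xs) @ e # drop a (take b xs @ drop (Suc b) xs)"
proof (induction xs arbitrary: a b)
  case (Cons x xs)
  then show ?case by (cases a; cases b) auto
qed simp

lemma box_comp_eqI:
  assumes "fst \<alpha> = fst \<alpha>'" "snd (snd \<beta>) = snd (snd \<beta>')"
    and "\<And>xs. length xs = fst \<alpha> \<Longrightarrow> fst (snd \<beta>) (fst (snd \<alpha>) xs) = fst (snd \<beta>') (fst (snd \<alpha>') xs)"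
  shows "box_comp \<beta> \<alpha> = box_comp \<beta>' \<alpha>'"
  using assms by (auto simp: box_comp_def compose_def cube_def)

lemma face_degen_ends:
  "fst (face k i e) = k - 1" "snd (snd (face k i e)) = k"
  "fst (degen k i) = k" "snd (snd (degen k i)) = k - 1"
  by (simp_all add: face_def degen_def)

lemma face_apply:
  "length xs = k - 1 \<Longrightarrow> fst (snd (face k i e)) xs = take (i - 1) xs @ e # drop (i - 1) xs"
  by (simp add: face_def cube_def)

lemma degen_apply:
  "length xs = k \<Longrightarrow> fst (snd (degen k i)) xs = take (i - 1) xs @ drop i xs"
  by (simp add: degen_def cube_def)

text \<open>The inserted coordinate is the one deleted. The result does not involve
  \<open>e\<close>, which is why the two faces in the direction of a degeneracy cancel.\<close>

lemma degen_face_eq: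
  assumes "1 \<le> i" "i \<le> n"
  shows "box_comp (degen n i) (face n i e) = box_idn (n - 1)"
proof -
  have "fst (snd (degen n i)) (fst (snd (face n i e)) xs) = xs" if "length xs = n - 1" for xs
    using that assms by (cases i) (simp_all add: face_apply degen_apply)
  then show ?thesis
    by (simp add: box_comp_def box_idn_def compose_def cube_def face_degen_ends restrict_def fun_eq_iff)
qed

text \<open>Interchanging insertion and deletion shifts only the index of the later coordinate.
  Since \<open>act\<close> is contravariant, the degeneracy on the right is applied last, which will
  exhibit a face of a degenerate cube as degenerate.\<close>

lemma degen_face_less:
  assumes "1 \<le> i" "i < j" "j \<le> n"
  shows "box_comp (degen n j) (face n i e) = box_comp (face (n - 1) i e) (degen (n - 1) (j - 1))"
proof (rule box_comp_eqI)
  \<comment> \<open>\<open>a\<close> and \<open>b\<close> are the zero-based insertion and deletion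
    positions on the right-hand side; \<open>j\<close> is at least 2 because
    \<open>i < j\<close>.\<close>
  obtain a b m where "i = Suc a" "j = Suc (Suc b)" "n = Suc m" "a \<le> b" "b < m"
    using assms by (cases i; cases j; cases "j - 1"; cases n) auto
  then show "fst (snd (degen n j)) (fst (snd (face n i e)) xs) =
      fst (snd (face (n - 1) i e)) (fst (snd (degen (n - 1) (j - 1))) xs)"
    if "length xs = fst (face n i e)" for xs
    using that remove_insert_less[of a b xs e] by (simp add: face_degen_ends face_apply degen_apply)
qed (simp_all add: face_degen_ends)

lemma degen_face_greater:
  assumes "1 \<le> j" "j < i" "i \<le> n"
  shows "box_comp (degen n j) (face n i e) = box_comp (face (n - 1) (i - 1) e) (degen (n - 1) j)"
proof (rule box_comp_eqI)
  obtain a b m where "i = Suc (Suc a)" "j = Suc b" "n = Suc m" "b \<le> a" "a < m"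
    using assms by (cases j; cases i; cases "i - 1"; cases n) auto
  then show "fst (snd (degen n j)) (fst (snd (face n i e)) xs) =
      fst (snd (face (n - 1) (i - 1) e)) (fst (snd (degen (n - 1) j)) xs)"
    if "length xs = fst (face n i e)" for xs
    using that remove_insert_greater[of b a xs e] by (simp add: face_degen_ends face_apply degen_apply)
qed (simp_all add: face_degen_ends)

section \<open>Cubical sets with local coefficients\<close>

lemma Hom_Box: "\<alpha> \<in> Hom Box m n \<longleftrightarrow> \<alpha> \<in> box_arrows \<and> fst \<alpha> = m \<and> snd (snd \<alpha>) = n"
  by (auto simp: Hom_def Box_def)

lemma degen_Hom: "1 \<le> i \<Longrightarrow> i \<le> n \<Longrightarrow> degen n i \<in> Hom Box n (n - 1)"
  using box_arrows.degen by (auto simp: Hom_Box degen_def)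

lemma face_Hom: "1 \<le> i \<Longrightarrow> i \<le> n \<Longrightarrow> face n i e \<in> Hom Box (n - 1) n"
  using box_arrows.face by (auto simp: Hom_Box face_def)

lemma box_comp_Hom: "\<alpha> \<in> Hom Box l m \<Longrightarrow> \<beta> \<in> Hom Box m n \<Longrightarrow> box_comp \<beta> \<alpha> \<in> Hom Box l n"
  using box_arrows.comp by (auto simp: Hom_Box) (auto simp: box_comp_def)

lemma box_idn_Hom: "box_idn n \<in> Hom Box n n"
  using box_arrows.idn by (auto simp: Hom_Box) (auto simp: box_idn_def)

text \<open>With the type of cubes as index type, all sets \<open>cubes X n\<close> and
  \<open>nondeg X n\<close> are admissible index sets for coproducts.\<close>

locale cubical_local_system =
  ab4_category A "TYPE('x)"
  for A :: "('o, 'm, 'z) preadd_scheme" (structure) +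
  fixes X :: "'x cubical" and F :: "('x, 'o, 'm) coeff"
  assumes cubical: "cubical_set X"
    and local_system: "local_system A X F"
begin

section \<open>Action on cubes and functoriality of the coefficients\<close>

lemma AMap_cubical:
  assumes "\<alpha> \<in> Hom Box m n"
  shows "AMap X \<alpha> = (cubes X n, act X \<alpha>, cubes X m)" "act X \<alpha> \<in> cubes X n \<rightarrow>\<^sub>E cubes X m"
proof -
  have "AMap X \<alpha> \<in> Hom SetCat (cubes X n) (cubes X m)"
    using cubical assms[unfolded Hom_Box] by (auto simp: cubical_set_def is_functor_def Op_def Box_def)
  then show "AMap X \<alpha> = (cubes X n, act X \<alpha>, cubes X m)" "act X \<alpha> \<in> cubes X n \<rightarrow>\<^sub>E cubes X m"
    by (auto simp: Hom_def SetCat_def act_def)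
qed

lemma act_cubes: "\<alpha> \<in> Hom Box m n \<Longrightarrow> x \<in> cubes X n \<Longrightarrow> act X \<alpha> x \<in> cubes X m"
  using AMap_cubical by blast

lemma act_comp:
  assumes "\<alpha> \<in> Hom Box l m" "\<beta> \<in> Hom Box m n" "x \<in> cubes X n"
  shows "act X (box_comp \<beta> \<alpha>) x = act X \<alpha> (act X \<beta> x)"
proof -
  have "AMap X (box_comp \<beta> \<alpha>) = Comp SetCat (AMap X \<alpha>) (AMap X \<beta>)"
    using cubical assms(1,2)[unfolded Hom_Box] by (auto simp: cubical_set_def is_functor_def Op_def Box_def)
  then have "act X (box_comp \<beta> \<alpha>) = compose (cubes X n) (act X \<alpha>) (act X \<beta>)"
    unfolding act_def[of X "box_comp \<beta> \<alpha>"] AMap_cubical(1)[OF assms(1)] AMap_cubical(1)[OF assms(2)]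
    by (simp add: SetCat_def)
  with assms(3) show ?thesis
    by (simp add: compose_def)
qed

lemma act_idn:
  assumes "x \<in> cubes X n"
  shows "act X (box_idn n) x = x"
proof -
  have "AMap X (box_idn n) = Idn SetCat (cubes X n)"
    using cubical by (auto simp: cubical_set_def is_functor_def Op_def Box_def)
  with assms show ?thesis
    by (simp add: act_def SetCat_def)
qed

lemma OMap_Obj: "x \<in> cubes X n \<Longrightarrow> OMap F (n, x) \<in> Obj A"
  using local_system by (auto simp: local_system_def is_functor_def Op_def Cubes_def)

lemma el_arrow:
  assumes "\<alpha> \<in> Hom Box m n" "x \<in> cubes X n"
  shows "((m, act X \<alpha> x), \<alpha>, (n, x)) \<in> Arr (Cubes X)"
  using assms act_cubes[OF assms] by (simp add: Cubes_def del: split_paired_Ex)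

lemma coeff_map_eq:
  "\<alpha> \<in> Hom Box m n \<Longrightarrow> coeff_map X F \<alpha> x = AMap F ((m, act X \<alpha> x), \<alpha>, (n, x))"
  by (auto simp: coeff_map_def Hom_def)

lemma coeff_map_isomorphism:
  assumes "\<alpha> \<in> Hom Box m n" "x \<in> cubes X n"
  shows "is_isomorphism A (OMap F (n, x)) (OMap F (m, act X \<alpha> x)) (coeff_map X F \<alpha> x)"
  using local_system el_arrow[OF assms]
  by (fastforce simp: local_system_def coeff_map_eq[OF assms(1)] Cubes_def)

lemma coeff_map_Hom:
  assumes "\<alpha> \<in> Hom Box m n" "x \<in> cubes X n"
  shows "coeff_map X F \<alpha> x \<in> Hom A (OMap F (n, x)) (OMap F (m, act X \<alpha> x))"
  using coeff_map_isomorphism[OF assms] by (simp add: is_isomorphism_def)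

lemma coeff_map_comp:
  assumes "\<alpha> \<in> Hom Box l m" "\<beta> \<in> Hom Box m n" "x \<in> cubes X n"
  shows "coeff_map X F (box_comp \<beta> \<alpha>) x = coeff_map X F \<alpha> (act X \<beta> x) \<bullet> coeff_map X F \<beta> x"
proof -
  \<comment> \<open>Arrows of \<open>Cubes X\<close> point from the image cube to the original one,
    so \<open>?a\<close> comes first there; \<open>F\<close> reverses the order.\<close>
  let ?a = "((l, act X \<alpha> (act X \<beta> x)), \<alpha>, (m, act X \<beta> x))"
  let ?b = "((m, act X \<beta> x), \<beta>, (n, x))"
  have arr: "?a \<in> Arr (Cubes X)" "?b \<in> Arr (Cubes X)"
    using el_arrow act_cubes assms by blast+
  have "Comp (Cubes X) ?b ?a = ((l, act X (box_comp \<beta> \<alpha>) x), box_comp \<beta> \<alpha>, (n, x))"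
    using act_comp[OF assms] by (simp add: Cubes_def Box_def)
  moreover have "AMap F (Comp (Cubes X) ?b ?a) = AMap F ?a \<bullet> AMap F ?b"
    using local_system arr unfolding local_system_def is_functor_def
    by (auto simp: Op_def Cubes_def)
  ultimately show ?thesis
    using coeff_map_eq[OF box_comp_Hom[OF assms(1,2)]] coeff_map_eq[OF assms(1)]
      coeff_map_eq[OF assms(2)] by simp
qed

lemma coeff_map_idn:
  assumes "x \<in> cubes X n"
  shows "coeff_map X F (box_idn n) x = Idn A (OMap F (n, x))"
proof -
  have "Idn (Cubes X) (n, x) = ((n, act X (box_idn n) x), box_idn n, (n, x))"
    using act_idn[OF assms] by (simp add: Cubes_def Box_def)
  moreover have "AMap F (Idn (Cubes X) (n, x)) = Idn A (OMap F (n, x))"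
    using local_system assms unfolding local_system_def is_functor_def
    by (auto simp: Op_def Cubes_def)
  ultimately show ?thesis
    using coeff_map_eq[OF box_idn_Hom] by simp
qed

section \<open>Chain objects with their face and degeneracy operators\<close>

lemma chain_coproduct:
  "is_coproduct A (cubes X n) (\<lambda>x. OMap F (n, x)) (chain A X F n) (chain_in A X F n)"
proof -
  have "\<exists>c u. is_coproduct A (cubes X n) (\<lambda>x. OMap F (n, x)) c u"
    using OMap_Obj by (intro coproducts) auto
  then show ?thesis
    unfolding chain_def chain_in_def by (elim exE) (rule coprod_is_coproduct)
qed

lemma nondeg_cubes: "x \<in> nondeg X n \<Longrightarrow> x \<in> cubes X n"
  by (simp add: nondeg_def)

lemma nondeg_chain_coproduct:
  "is_coproduct A (nondeg X n) (\<lambda>x. OMap F (n, x)) (nondeg_chain A X F n)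
    (coprod_in A (nondeg X n) (\<lambda>x. OMap F (n, x)))"
proof -
  have "\<exists>c u. is_coproduct A (nondeg X n) (\<lambda>x. OMap F (n, x)) c u"
    using OMap_Obj nondeg_cubes by (intro coproducts) auto
  then show ?thesis
    unfolding nondeg_chain_def by (elim exE) (rule coprod_is_coproduct)
qed

lemma chain_Obj: "chain A X F n \<in> Obj A" "nondeg_chain A X F n \<in> Obj A"
  using chain_coproduct nondeg_chain_coproduct unfolding is_coproduct_def by blast+

lemma chain_in_Hom:
  "x \<in> cubes X n \<Longrightarrow> chain_in A X F n x \<in> Hom A (OMap F (n, x)) (chain A X F n)"
  using is_coproduct_in[OF chain_coproduct] .

lemma chain_in_coeff_map_Hom:
  assumes "\<alpha> \<in> Hom Box m n" "x \<in> cubes X n"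
  shows "chain_in A X F m (act X \<alpha> x) \<bullet> coeff_map X F \<alpha> x
    \<in> Hom A (OMap F (n, x)) (chain A X F m)"
  using Comp_Hom[OF coeff_map_Hom[OF assms] chain_in_Hom] act_cubes[OF assms] by blast

lemma chain_face:
  assumes "1 \<le> i" "i \<le> n"
  shows chain_face_Hom: "chain_face A X F n i e \<in> Hom A (chain A X F n) (chain A X F (n - 1))"
    and chain_face_in: "x \<in> cubes X n \<Longrightarrow> chain_face A X F n i e \<bullet> chain_in A X F n x =
      chain_in A X F (n - 1) (act X (face n i e) x) \<bullet> coeff_map X F (face n i e) x"
  using copair[OF chain_coproduct chain_Obj(1)[of "n - 1"] chain_in_coeff_map_Hom[OF face_Hom[OF assms]]]
  unfolding chain_face_def by (auto simp: chain_def chain_in_def)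

lemma chain_degen:
  assumes "1 \<le> i" "i \<le> n"
  shows chain_degen_Hom: "chain_degen A X F n i \<in> Hom A (chain A X F (n - 1)) (chain A X F n)"
    and chain_degen_in: "y \<in> cubes X (n - 1) \<Longrightarrow>
      chain_degen A X F n i \<bullet> chain_in A X F (n - 1) y =
      chain_in A X F n (act X (degen n i) y) \<bullet> coeff_map X F (degen n i) y"
  using copair[OF chain_coproduct chain_Obj(1)[of n] chain_in_coeff_map_Hom[OF degen_Hom[OF assms]]]
  unfolding chain_degen_def by (auto simp: chain_def chain_in_def)

text \<open>At \<open>n = 0\<close> the sum is empty and truncated subtraction makes the
  differential the zero endomorphism of \<open>chain A X F 0\<close>.\<close>

lemma chain_diff_Hom: "chain_diff A X F n \<in> Hom A (chain A X F n) (chain A X F (n - 1))"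
proof -
  interpret G: abelian_group "HomGrp A (chain A X F n) (chain A X F (n - 1))"
    using HomGrp chain_Obj by blast
  have "chain_diff A X F n \<in> carrier (HomGrp A (chain A X F n) (chain A X F (n - 1)))"
    unfolding chain_diff_def Let_def
    by (intro G.finsum_closed Pi_I G.add.int_pow_closed G.minus_closed)
      (use chain_face_Hom in \<open>auto simp: carrier_HomGrp\<close>)
  then show ?thesis by (simp add: carrier_HomGrp)
qed

text \<open>Composition with \<open>p\<close> and \<open>g\<close> is additive, so each pair of
  opposite faces can be treated separately. In the application \<open>p\<close> is the projection
  and \<open>g\<close> includes a degenerate summand.\<close>

lemma chain_diff_sandwich_zero:
  assumes p: "p \<in> Hom A (chain A X F (n - 1)) c" and g: "g \<in> Hom A a (chain A X F n)"
    and eq: "\<And>i. 1 \<le> i \<Longrightarrow> i \<le> n \<Longrightarrow>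
      p \<bullet> chain_face A X F n i False \<bullet> g = p \<bullet> chain_face A X F n i True \<bullet> g"
  shows "p \<bullet> chain_diff A X F n \<bullet> g = Zer A a c"
proof -
  interpret h: abelian_group_hom "HomGrp A (chain A X F n) (chain A X F (n - 1))" "HomGrp A a c"
    "\<lambda>t. p \<bullet> t \<bullet> g"
    using sandwich_hom[OF p g] .
  have "p \<bullet> chain_diff A X F n \<bullet> g = \<zero>\<^bsub>HomGrp A a c\<^esub>"
    unfolding chain_diff_def Let_def
    by (rule h.hom_signed_sum_zero) (use eq chain_face_Hom in \<open>auto simp: HomGrp_def\<close>)
  then show ?thesis by (simp add: HomGrp_def)
qed

section \<open>The total degeneracy map\<close>

lemma degen_total:
  shows degen_total_Hom: "degen_total A X F n \<in>
      Hom A (coprod A {1..n} (\<lambda>_. chain A X F (n - 1))) (chain A X F n)"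
    and degen_total_in: "i \<in> {1..n} \<Longrightarrow>
      degen_total A X F n \<bullet> coprod_in A {1..n} (\<lambda>_. chain A X F (n - 1)) i = chain_degen A X F n i"
    and degen_total_coproduct: "is_coproduct A {1..n} (\<lambda>_. chain A X F (n - 1))
      (coprod A {1..n} (\<lambda>_. chain A X F (n - 1))) (coprod_in A {1..n} (\<lambda>_. chain A X F (n - 1)))"
proof -
  obtain c u where cu: "is_coproduct A {1..n} (\<lambda>_. chain A X F (n - 1)) c u"
    using finite_coproducts[of "{1..n}"] chain_Obj by fastforce
  then show "is_coproduct A {1..n} (\<lambda>_. chain A X F (n - 1))
      (coprod A {1..n} (\<lambda>_. chain A X F (n - 1))) (coprod_in A {1..n} (\<lambda>_. chain A X F (n - 1)))"
    by (rule coprod_is_coproduct)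
  note c = copair[OF cu chain_Obj(1)[of n], of "chain_degen A X F n"]
  show "degen_total A X F n \<in> Hom A (coprod A {1..n} (\<lambda>_. chain A X F (n - 1))) (chain A X F n)"
    unfolding degen_total_def by (rule c(1)) (use chain_degen_Hom in auto)
  show "i \<in> {1..n} \<Longrightarrow>
      degen_total A X F n \<bullet> coprod_in A {1..n} (\<lambda>_. chain A X F (n - 1)) i = chain_degen A X F n i"
    unfolding degen_total_def by (rule c(2)) (use chain_degen_Hom in auto)
qed

text \<open>Vanishing is tested first on the direction \<open>i\<close> and then on the cube
  \<open>y\<close>. For \<open>n = 0\<close> no cube is degenerate and the source is an empty
  coproduct.\<close>

lemma comp_degen_total_zero_iff:
  assumes f: "f \<in> Hom A (chain A X F n) b"
  shows "f \<bullet> degen_total A X F n = Zer A (Dom A (degen_total A X F n)) b \<longleftrightarrow>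
    (\<forall>x\<in>cubes X n. degenerate X n x \<longrightarrow> f \<bullet> chain_in A X F n x = Zer A (OMap F (n, x)) b)"
    (is "?L \<longleftrightarrow> ?R")
proof -
  let ?S = "coprod A {1..n} (\<lambda>_. chain A X F (n - 1))"
  let ?u = "coprod_in A {1..n} (\<lambda>_. chain A X F (n - 1))"
  note T = degen_total_Hom[of n] and S = degen_total_coproduct[of n]
  have b: "b \<in> Obj A" using Hom_Obj f by blast
  have D: "Dom A (degen_total A X F n) = ?S" using T by (simp add: Hom_def)
  have SO: "?S \<in> Obj A" using Hom_Obj T by blast
  have fs: "f \<bullet> degen_total A X F n \<bullet> ?u i = f \<bullet> chain_degen A X F n i" if "i \<in> {1..n}" for i
    using Comp_assoc[OF is_coproduct_in[OF S that] T f] degen_total_in[OF that] by simp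
  have summand: "f \<bullet> chain_degen A X F n i \<bullet> chain_in A X F (n - 1) y =
      f \<bullet> chain_in A X F n (act X (degen n i) y) \<bullet> coeff_map X F (degen n i) y"
    if i: "1 \<le> i" "i \<le> n" and y: "y \<in> cubes X (n - 1)" for i y
    using Comp_assoc[OF chain_in_Hom[OF y] chain_degen_Hom[OF i] f] chain_degen_in[OF i y]
      Comp_assoc[OF coeff_map_Hom[OF degen_Hom[OF i] y]
        chain_in_Hom[OF act_cubes[OF degen_Hom[OF i] y]] f] by simp
  show ?thesis
  proof
    assume L: ?L
    show ?R
    proof (intro ballI impI)
      fix x assume x: "x \<in> cubes X n" "degenerate X n x"
      then obtain i y where i: "1 \<le> i" "i \<le> n" and y: "y \<in> cubes X (n - 1)"
        and xy: "x = act X (degen n i) y"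
        by (auto simp: degenerate_def)
      note iso = coeff_map_isomorphism[OF degen_Hom[OF i] y]
      note hom = coeff_map_Hom[OF degen_Hom[OF i] y]
      have "i \<in> {1..n}" using i by simp
      then have "f \<bullet> chain_degen A X F n i = Zer A (chain A X F (n - 1)) b"
        using fs L D Zer_Comp[OF is_coproduct_in[OF S] b] by simp
      then have "f \<bullet> chain_in A X F n x \<bullet> coeff_map X F (degen n i) y = Zer A (OMap F (n - 1, y)) b"
        using summand[OF i y] Zer_Comp[OF chain_in_Hom[OF y] b] xy by simp
      also have "\<dots> = Zer A (OMap F (n, x)) b \<bullet> coeff_map X F (degen n i) y"
        using Zer_Comp[OF hom b] xy by simp
      \<comment> \<open>The coefficient map of \<open>degen n i\<close> is an isomorphism and
        cancels.\<close>
      finally show "f \<bullet> chain_in A X F n x = Zer A (OMap F (n, x)) b"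
        using isomorphism_right_cancel[OF iso] Comp_Hom[OF chain_in_Hom[OF x(1)] f]
          Zer_Hom[OF OMap_Obj[OF x(1)] b] xy by simp
    qed
  next
    assume R: ?R
    show ?L
      unfolding D
    proof (rule coproduct_hom_eqI[OF S])
      show "f \<bullet> degen_total A X F n \<in> Hom A ?S b" "Zer A ?S b \<in> Hom A ?S b"
        using Comp_Hom[OF T f] Zer_Hom[OF SO b] .
      fix i assume I: "i \<in> {1..n}"
      then have i: "1 \<le> i" "i \<le> n" by auto
      have "f \<bullet> chain_degen A X F n i = Zer A (chain A X F (n - 1)) b"
      proof (rule coproduct_hom_eqI[OF chain_coproduct])
        show "f \<bullet> chain_degen A X F n i \<in> Hom A (chain A X F (n - 1)) b"
          "Zer A (chain A X F (n - 1)) b \<in> Hom A (chain A X F (n - 1)) b"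
          using Comp_Hom[OF chain_degen_Hom[OF i] f] Zer_Hom[OF chain_Obj(1) b] .
        fix y assume y: "y \<in> cubes X (n - 1)"
        have "act X (degen n i) y \<in> cubes X n"
          using act_cubes[OF degen_Hom[OF i] y] .
        moreover have "degenerate X n (act X (degen n i) y)"
          using y I by (auto simp: degenerate_def)
        ultimately have "f \<bullet> chain_in A X F n (act X (degen n i) y) =
            Zer A (OMap F (n, act X (degen n i) y)) b"
          using R by blast
        then show "f \<bullet> chain_degen A X F n i \<bullet> chain_in A X F (n - 1) y =
            Zer A (chain A X F (n - 1)) b \<bullet> chain_in A X F (n - 1) y"
          using summand[OF i y] Zer_Comp[OF coeff_map_Hom[OF degen_Hom[OF i] y] b]
            Zer_Comp[OF chain_in_Hom[OF y] b] by simp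
      qed
      then show "f \<bullet> degen_total A X F n \<bullet> ?u i = Zer A ?S b \<bullet> ?u i"
        using fs[OF I] Zer_Comp[OF is_coproduct_in[OF S I] b] by simp
    qed
  qed
qed

section \<open>The projection as a cokernel\<close>

lemma nondeg_proj:
  shows nondeg_proj_Hom: "nondeg_proj A X F n \<in> Hom A (chain A X F n) (nondeg_chain A X F n)"
    and nondeg_proj_in: "x \<in> cubes X n \<Longrightarrow> nondeg_proj A X F n \<bullet> chain_in A X F n x =
      (if x \<in> nondeg X n then coprod_in A (nondeg X n) (\<lambda>x. OMap F (n, x)) x
       else Zer A (OMap F (n, x)) (nondeg_chain A X F n))"
proof -
  let ?f = "\<lambda>x. if x \<in> nondeg X n then coprod_in A (nondeg X n) (\<lambda>x. OMap F (n, x)) x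
    else Zer A (OMap F (n, x)) (nondeg_chain A X F n)"
  have "?f x \<in> Hom A (OMap F (n, x)) (nondeg_chain A X F n)" if "x \<in> cubes X n" for x
    using is_coproduct_in[OF nondeg_chain_coproduct] Zer_Hom[OF OMap_Obj chain_Obj(2)] that by auto
  note c = copair[OF chain_coproduct chain_Obj(2)[of n], of n ?f, OF this]
  show "nondeg_proj A X F n \<in> Hom A (chain A X F n) (nondeg_chain A X F n)"
    using c(1) by (simp add: nondeg_proj_def chain_def)
  show "x \<in> cubes X n \<Longrightarrow> nondeg_proj A X F n \<bullet> chain_in A X F n x = ?f x"
    using c(2) by (simp add: nondeg_proj_def chain_in_def)
qed

lemma nondeg_proj_degenerate:
  assumes "x \<in> cubes X n" "degenerate X n x"
  shows "nondeg_proj A X F n \<bullet> chain_in A X F n x = Zer A (OMap F (n, x)) (nondeg_chain A X F n)"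
  using nondeg_proj_in[OF assms(1)] assms(2) by (simp add: nondeg_def)

text \<open>A morphism that kills the total degeneracy map vanishes on the degenerate summands, so
  it amounts to a family on the nondegenerate ones. Its factorizations through the projection are
  the copairings of that family.\<close>

lemma nondeg_proj_cokernel: "is_cokernel A (degen_total A X F n) (nondeg_proj A X F n)"
  unfolding is_cokernel_def
proof (intro conjI allI ballI impI)
  note T = degen_total_Hom[of n] and P = nondeg_proj_Hom[of n]
  show "degen_total A X F n \<in> Arr A" "nondeg_proj A X F n \<in> Arr A"
    "Dom A (nondeg_proj A X F n) = Cod A (degen_total A X F n)"
    using T P by (auto simp: Hom_def)
  have "Cod A (nondeg_proj A X F n) = nondeg_chain A X F n"
    and C: "Cod A (degen_total A X F n) = chain A X F n"
    using P T by (auto simp: Hom_def)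
  then show "nondeg_proj A X F n \<bullet> degen_total A X F n =
      Zer A (Dom A (degen_total A X F n)) (Cod A (nondeg_proj A X F n))"
    using comp_degen_total_zero_iff[OF P] nondeg_proj_degenerate by simp
  fix b f
  assume "f \<in> Hom A (Cod A (degen_total A X F n)) b"
    and zero: "f \<bullet> degen_total A X F n = Zer A (Dom A (degen_total A X F n)) b"
  then have f: "f \<in> Hom A (chain A X F n) b" using C by simp
  then have b: "b \<in> Obj A" using Hom_Obj by blast
  let ?u = "coprod_in A (nondeg X n) (\<lambda>x. OMap F (n, x))"
  note N = nondeg_chain_coproduct[of n]
  have fin: "\<forall>x\<in>nondeg X n. f \<bullet> chain_in A X F n x \<in> Hom A (OMap F (n, x)) b"
    using Comp_Hom[OF chain_in_Hom f] nondeg_cubes by blast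
  \<comment> \<open>Translates the triangle over the projection into the equations of a copairing,
    so that existence and uniqueness both come from the coproduct of the nondegenerate
    summands.\<close>
  have factor: "h \<bullet> nondeg_proj A X F n = f \<longleftrightarrow>
      (\<forall>x\<in>nondeg X n. h \<bullet> ?u x = f \<bullet> chain_in A X F n x)"
    if h: "h \<in> Hom A (nondeg_chain A X F n) b" for h
  proof
    assume hp: "h \<bullet> nondeg_proj A X F n = f"
    show "\<forall>x\<in>nondeg X n. h \<bullet> ?u x = f \<bullet> chain_in A X F n x"
    proof
      fix x assume x: "x \<in> nondeg X n"
      note xc = nondeg_cubes[OF x]
      show "h \<bullet> ?u x = f \<bullet> chain_in A X F n x"
        using Comp_assoc[OF chain_in_Hom[OF xc] P h] nondeg_proj_in[OF xc] x hp by simp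
    qed
  next
    assume hu: "\<forall>x\<in>nondeg X n. h \<bullet> ?u x = f \<bullet> chain_in A X F n x"
    show "h \<bullet> nondeg_proj A X F n = f"
    proof (rule coproduct_hom_eqI[OF chain_coproduct])
      show "h \<bullet> nondeg_proj A X F n \<in> Hom A (chain A X F n) b" "f \<in> Hom A (chain A X F n) b"
        using Comp_Hom[OF P h] f .
      fix x assume x: "x \<in> cubes X n"
      show "h \<bullet> nondeg_proj A X F n \<bullet> chain_in A X F n x = f \<bullet> chain_in A X F n x"
      \<comment> \<open>On a degenerate summand both sides vanish: the left by the projection, the
        right by \<open>zero\<close>.\<close>
      proof (cases "degenerate X n x")
        case True
        then have "f \<bullet> chain_in A X F n x = Zer A (OMap F (n, x)) b"
          using comp_degen_total_zero_iff[OF f] zero x by blast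
        then show ?thesis
          using Comp_assoc[OF chain_in_Hom[OF x] P h] nondeg_proj_degenerate[OF x True]
            Comp_Zer[OF h OMap_Obj[OF x]] by simp
      next
        case False
        with x have "x \<in> nondeg X n" by (simp add: nondeg_def)
        then show ?thesis
          using Comp_assoc[OF chain_in_Hom[OF x] P h] nondeg_proj_in[OF x] hu by simp
      qed
    qed
  qed
  have "\<exists>!h. h \<in> Hom A (nondeg_chain A X F n) b \<and>
      (\<forall>x\<in>nondeg X n. h \<bullet> ?u x = f \<bullet> chain_in A X F n x)"
    using N[unfolded is_coproduct_def, THEN conjunct2, THEN conjunct2, rule_format, OF b,
        of "\<lambda>x. f \<bullet> chain_in A X F n x"] fin by simp
  then show "\<exists>!h. h \<in> Hom A (Cod A (nondeg_proj A X F n)) b \<and> h \<bullet> nondeg_proj A X F n = f"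
    using factor \<open>Cod A (nondeg_proj A X F n) = nondeg_chain A X F n\<close> by (metis (no_types, lifting))
qed

text \<open>The injection of a nondegenerate summand is the projection composed with the injection
  of the same cube into all chains, so the hypothesis can be read off on each summand. This yields
  uniqueness of the differential.\<close>

lemma nondeg_proj_right_cancel:
  assumes "g \<in> Hom A (nondeg_chain A X F n) b" "h \<in> Hom A (nondeg_chain A X F n) b"
    and "g \<bullet> nondeg_proj A X F n = h \<bullet> nondeg_proj A X F n"
  shows "g = h"
proof (rule coproduct_hom_eqI[OF nondeg_chain_coproduct assms(1,2)])
  let ?u = "coprod_in A (nondeg X n) (\<lambda>x. OMap F (n, x))"
  fix x assume x: "x \<in> nondeg X n"
  note xc = nondeg_cubes[OF x]
  show "g \<bullet> ?u x = h \<bullet> ?u x"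
    using Comp_assoc[OF chain_in_Hom[OF xc] nondeg_proj_Hom assms(1)]
      Comp_assoc[OF chain_in_Hom[OF xc] nondeg_proj_Hom assms(2)] nondeg_proj_in[OF xc] x assms(3)
    by simp
qed

section \<open>Faces of degenerate cubes\<close>

text \<open>A cubical identity moves the degeneracy outside the face. As \<open>i\<close> and
  \<open>j\<close> are distinct, the shifted indices stay within \<open>{1..n - 1}\<close>.\<close>

lemma degenerate_face_degen:
  assumes i: "1 \<le> i" "i \<le> n" and j: "1 \<le> j" "j \<le> n" and ne: "i \<noteq> j" and y: "y \<in> cubes X (n - 1)"
  shows "degenerate X (n - 1) (act X (face n i e) (act X (degen n j) y))"
proof -
  \<comment> \<open>Both orders of \<open>i\<close> and \<open>j\<close> lead to an identity of this
    shape; \<open>k\<close> and \<open>l\<close> are the new directions of the face and of the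
    degeneracy.\<close>
  have deg: "degenerate X (n - 1) (act X (face n i e) (act X (degen n j) y))"
    if eq: "box_comp (degen n j) (face n i e) = box_comp (face (n - 1) k e) (degen (n - 1) l)"
      and k: "1 \<le> k" "k \<le> n - 1" and l: "1 \<le> l" "l \<le> n - 1" for k l
  proof -
    have "act X (face n i e) (act X (degen n j) y) = act X (box_comp (degen n j) (face n i e)) y"
      using act_comp[OF face_Hom[OF i] degen_Hom[OF j] y] by simp
    also have "\<dots> = act X (degen (n - 1) l) (act X (face (n - 1) k e) y)"
      using act_comp[OF degen_Hom[OF l] face_Hom[OF k] y] eq by simp
    finally show ?thesis
      using act_cubes[OF face_Hom[OF k] y, of e] l unfolding degenerate_def
      by (intro bexI[of _ l] bexI[of _ "act X (face (n - 1) k e) y"]) simp_all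
  qed
  show ?thesis
  proof (cases "i < j")
    case True
    show ?thesis
      by (rule deg[OF degen_face_less[OF i(1) True j(2)]]) (use i j True in auto)
  next
    case False
    with ne have "j < i" by simp
    show ?thesis
      by (rule deg[OF degen_face_greater[OF j(1) \<open>j < i\<close> i(2)]]) (use i j \<open>j < i\<close> in auto)
  qed
qed

text \<open>For a cube degenerate in direction \<open>j\<close> there are two mechanisms: in
  direction \<open>j\<close> the faces agree before projecting, while in any other direction both
  are degenerate and the projection kills them.\<close>

lemma nondeg_proj_face_degenerate:
  assumes x: "x \<in> cubes X n" "degenerate X n x" and i: "1 \<le> i" "i \<le> n"
  shows "nondeg_proj A X F (n - 1) \<bullet> chain_face A X F n i False \<bullet> chain_in A X F n x =
    nondeg_proj A X F (n - 1) \<bullet> chain_face A X F n i True \<bullet> chain_in A X F n x"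
proof -
  obtain j y where j: "1 \<le> j" "j \<le> n" and y: "y \<in> cubes X (n - 1)" and xy: "x = act X (degen n j) y"
    using x(2) by (auto simp: degenerate_def)
  let ?p = "nondeg_proj A X F (n - 1)"
  have face: "?p \<bullet> chain_face A X F n i e \<bullet> chain_in A X F n x =
      ?p \<bullet> (chain_face A X F n i e \<bullet> chain_in A X F n x)" for e
    using Comp_assoc[OF chain_in_Hom[OF x(1)] chain_face_Hom[OF i] nondeg_proj_Hom] by simp
  show ?thesis
  proof (cases "i = j")
    case True
    note iso = coeff_map_isomorphism[OF degen_Hom[OF j] y, folded xy]
    \<comment> \<open>Precomposing with the coefficient map of the degeneracy leaves the plain
      inclusion of \<open>y\<close> for either \<open>e\<close>: by \<open>degen_face_eq\<close>
      both the cubes and the coefficients return to their start. The invertible map is cancelled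
      afterwards.\<close>
    have "chain_face A X F n i e \<bullet> chain_in A X F n x \<bullet> coeff_map X F (degen n j) y =
        chain_in A X F (n - 1) y" for e
    proof -
      have "act X (face n i e) x = y"
        using act_comp[OF face_Hom[OF i] degen_Hom[OF j] y] degen_face_eq[OF i] True act_idn[OF y] xy
        by simp
      moreover have "coeff_map X F (face n i e) x \<bullet> coeff_map X F (degen n j) y =
          Idn A (OMap F (n - 1, y))"
        using coeff_map_comp[OF face_Hom[OF i] degen_Hom[OF j] y] degen_face_eq[OF i] True
          coeff_map_idn[OF y] xy by simp
      ultimately show ?thesis
        using chain_face_in[OF i x(1)] Comp_Idn[OF chain_in_Hom[OF y]] xy
          Comp_assoc[OF coeff_map_Hom[OF degen_Hom[OF j] y, folded xy] coeff_map_Hom[OF face_Hom[OF i] x(1)]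
            chain_in_Hom[OF act_cubes[OF face_Hom[OF i] x(1)]]] by metis
    qed
    then have "chain_face A X F n i False \<bullet> chain_in A X F n x =
        chain_face A X F n i True \<bullet> chain_in A X F n x"
      using isomorphism_right_cancel[OF iso Comp_Hom[OF chain_in_Hom[OF x(1)] chain_face_Hom[OF i]]
          Comp_Hom[OF chain_in_Hom[OF x(1)] chain_face_Hom[OF i]]] by metis
    with face show ?thesis by simp
  next
    case False
    have "?p \<bullet> (chain_face A X F n i e \<bullet> chain_in A X F n x) =
        Zer A (OMap F (n, x)) (nondeg_chain A X F (n - 1))" for e
    proof -
      let ?z = "act X (face n i e) x"
      note c = coeff_map_Hom[OF face_Hom[OF i] x(1), of e]
      have z: "?z \<in> cubes X (n - 1)" using act_cubes[OF face_Hom[OF i] x(1)] .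
      have "degenerate X (n - 1) ?z"
        using degenerate_face_degen[OF i j False y] xy by simp
      then show ?thesis
        using nondeg_proj_degenerate[OF z] Comp_assoc[OF c chain_in_Hom[OF z] nondeg_proj_Hom]
          Zer_Comp[OF c chain_Obj(2)] chain_face_in[OF i x(1)] by simp
    qed
    with face show ?thesis by simp
  qed
qed

text \<open>Only degenerate summands need checking, and there opposite faces agree after projection.
  This lets the differential descend to the quotients.\<close>

lemma nondeg_proj_diff_degen_total:
  "nondeg_proj A X F (n - 1) \<bullet> chain_diff A X F n \<bullet> degen_total A X F n =
    Zer A (Dom A (degen_total A X F n)) (nondeg_chain A X F (n - 1))"
  unfolding comp_degen_total_zero_iff[OF Comp_Hom[OF chain_diff_Hom nondeg_proj_Hom]]
  by (intro ballI impI chain_diff_sandwich_zero[OF nondeg_proj_Hom chain_in_Hom]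
      nondeg_proj_face_degenerate)

section \<open>The normalized complex and its differential\<close>

text \<open>\<open>coker\<close> is a choice; the projection witnesses that there is something to
  choose.\<close>

lemma norm_quot_cokernel: "is_cokernel A (degen_total A X F n) (norm_quot A X F n)"
  unfolding norm_quot_def coker_def by (rule someI, rule nondeg_proj_cokernel)

lemma norm_quot_Hom: "norm_quot A X F n \<in> Hom A (chain A X F n) (norm_chain A X F n)"
  using norm_quot_cokernel[of n] degen_total_Hom[of n]
  by (auto simp: is_cokernel_def Hom_def norm_chain_def)

text \<open>Both maps are cokernels of \<open>degen_total\<close>. The triangle is kept because it
  makes the isomorphisms comparable with the differentials.\<close>

lemma norm_chain_isomorphism:
  "\<exists>\<phi>. is_isomorphism A (norm_chain A X F n) (nondeg_chain A X F n) \<phi> \<and>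
    \<phi> \<bullet> norm_quot A X F n = nondeg_proj A X F n"
proof -
  have "Cod A (nondeg_proj A X F n) = nondeg_chain A X F n"
    using nondeg_proj_Hom[of n] by (simp add: Hom_def)
  then show ?thesis
    using cokernel_isomorphism[OF norm_quot_cokernel nondeg_proj_cokernel, of n]
    unfolding norm_chain_def by metis
qed

text \<open>\<open>norm_diff\<close> is a definite description, so unique existence must come from
  the universal property of the cokernel. The vanishing this requires is known for the projection
  and is carried to \<open>norm_quot\<close> by the inverse \<open>\<psi>\<close> of the comparison
  isomorphism.\<close>

lemma norm_diff:
  shows norm_diff_Hom: "norm_diff A X F n \<in> Hom A (norm_chain A X F n) (norm_chain A X F (n - 1))"
    and norm_diff_quot:
      "norm_diff A X F n \<bullet> norm_quot A X F n = norm_quot A X F (n - 1) \<bullet> chain_diff A X F n"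
proof -
  note T = degen_total_Hom[of n] and P = nondeg_proj_Hom[of "n - 1"] and Q = norm_quot_Hom[of "n - 1"]
    and D = chain_diff_Hom[of n]
  note QD = Comp_Hom[OF D Q]
  obtain \<phi> where \<phi>: "is_isomorphism A (norm_chain A X F (n - 1)) (nondeg_chain A X F (n - 1)) \<phi>"
    "\<phi> \<bullet> norm_quot A X F (n - 1) = nondeg_proj A X F (n - 1)"
    using norm_chain_isomorphism by blast
  then obtain \<psi> where \<psi>: "\<phi> \<in> Hom A (norm_chain A X F (n - 1)) (nondeg_chain A X F (n - 1))"
    "\<psi> \<in> Hom A (nondeg_chain A X F (n - 1)) (norm_chain A X F (n - 1))"
    "\<psi> \<bullet> \<phi> = Idn A (norm_chain A X F (n - 1))"
    by (auto simp: is_isomorphism_def)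
  have "norm_quot A X F (n - 1) = \<psi> \<bullet> nondeg_proj A X F (n - 1)"
    using Comp_assoc[OF Q \<psi>(1,2)] \<psi>(3) Idn_Comp[OF Q] \<phi>(2) by simp
  then have "norm_quot A X F (n - 1) \<bullet> chain_diff A X F n \<bullet> degen_total A X F n =
      \<psi> \<bullet> (nondeg_proj A X F (n - 1) \<bullet> chain_diff A X F n \<bullet> degen_total A X F n)"
    using Comp_assoc[OF D P \<psi>(2)] Comp_assoc[OF T Comp_Hom[OF D P] \<psi>(2)] by simp
  also have "\<dots> = Zer A (Dom A (degen_total A X F n)) (norm_chain A X F (n - 1))"
    using nondeg_proj_diff_degen_total Comp_Zer[OF \<psi>(2)] Hom_Obj[OF T] T by (simp add: Hom_def)
  finally have zero: "norm_quot A X F (n - 1) \<bullet> chain_diff A X F n \<bullet> degen_total A X F n =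
      Zer A (Dom A (degen_total A X F n)) (norm_chain A X F (n - 1))" .
  have "Cod A (degen_total A X F n) = chain A X F n"
    using T by (simp add: Hom_def)
  then have "\<exists>!h. h \<in> Hom A (norm_chain A X F n) (norm_chain A X F (n - 1)) \<and>
      h \<bullet> norm_quot A X F n = norm_quot A X F (n - 1) \<bullet> chain_diff A X F n"
    using norm_quot_cokernel[of n] QD zero
    unfolding is_cokernel_def norm_chain_def by simp
  from theI'[OF this]
  show "norm_diff A X F n \<in> Hom A (norm_chain A X F n) (norm_chain A X F (n - 1))"
    "norm_diff A X F n \<bullet> norm_quot A X F n = norm_quot A X F (n - 1) \<bullet> chain_diff A X F n"
    by (auto simp: norm_diff_def)
qed

end

theorem theorem6p2:
  fixes A :: "('o, 'm) preadd" and X :: "'x cubical" and F :: "('x, 'o, 'm) coeff"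
  assumes "ab4_category TYPE('x) A"
    and "cubical_set X"
    and "local_system A X F"
  shows "\<exists>\<phi> dN.
    (\<forall>n. is_isomorphism A (norm_chain A X F n) (nondeg_chain A X F n) (\<phi> n)) \<and>
    (\<forall>n\<ge>1.
       dN n \<in> Hom A (nondeg_chain A X F n) (nondeg_chain A X F (n - 1)) \<and>
       dN n \<bullet>\<^bsub>A\<^esub> \<phi> n = \<phi> (n - 1) \<bullet>\<^bsub>A\<^esub> norm_diff A X F n \<and>
       dN n \<bullet>\<^bsub>A\<^esub> nondeg_proj A X F n = nondeg_proj A X F (n - 1) \<bullet>\<^bsub>A\<^esub> chain_diff A X F n \<and>
       (\<forall>h \<in> Hom A (nondeg_chain A X F n) (nondeg_chain A X F (n - 1)).
          h \<bullet>\<^bsub>A\<^esub> nondeg_proj A X F n = nondeg_proj A X F (n - 1) \<bullet>\<^bsub>A\<^esub> chain_diff A X F n \<longrightarrow>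
          h = dN n))"
proof -
  interpret cubical_local_system A X F
    using assms by (intro cubical_local_system.intro cubical_local_system_axioms.intro)
  obtain \<phi> where iso: "\<And>n. is_isomorphism A (norm_chain A X F n) (nondeg_chain A X F n) (\<phi> n)"
    and \<phi>q: "\<And>n. \<phi> n \<bullet>\<^bsub>A\<^esub> norm_quot A X F n = nondeg_proj A X F n"
    using norm_chain_isomorphism by metis
  then obtain \<psi> where \<phi>: "\<And>n. \<phi> n \<in> Hom A (norm_chain A X F n) (nondeg_chain A X F n)"
    and \<psi>: "\<And>n. \<psi> n \<in> Hom A (nondeg_chain A X F n) (norm_chain A X F n)"
    and inv: "\<And>n. \<psi> n \<bullet>\<^bsub>A\<^esub> \<phi> n = Idn A (norm_chain A X F n)"
    unfolding is_isomorphism_def by metis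
  \<comment> \<open>The normalized differential transported along the comparison
    isomorphisms.\<close>
  define dN where "dN n = \<phi> (n - 1) \<bullet>\<^bsub>A\<^esub> norm_diff A X F n \<bullet>\<^bsub>A\<^esub> \<psi> n" for n
  have \<phi>d: "\<phi> (n - 1) \<bullet>\<^bsub>A\<^esub> norm_diff A X F n \<in> Hom A (norm_chain A X F n) (nondeg_chain A X F (n - 1))" for n
    using Comp_Hom[OF norm_diff_Hom \<phi>] .
  have dN: "dN n \<in> Hom A (nondeg_chain A X F n) (nondeg_chain A X F (n - 1))" for n
    unfolding dN_def using Comp_Hom[OF \<psi> \<phi>d] .
  have comm: "dN n \<bullet>\<^bsub>A\<^esub> \<phi> n = \<phi> (n - 1) \<bullet>\<^bsub>A\<^esub> norm_diff A X F n" for n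
    using Comp_assoc[OF \<phi> \<psi> \<phi>d] inv Comp_Idn[OF \<phi>d] by (simp add: dN_def)
  have square: "dN n \<bullet>\<^bsub>A\<^esub> nondeg_proj A X F n = nondeg_proj A X F (n - 1) \<bullet>\<^bsub>A\<^esub> chain_diff A X F n" for n
  proof -
    \<comment> \<open>Writing the projection as \<open>\<phi> n\<close> after
      \<open>norm_quot\<close> turns the square into the defining square of
      \<open>norm_diff\<close>.\<close>
    have "dN n \<bullet>\<^bsub>A\<^esub> nondeg_proj A X F n = \<phi> (n - 1) \<bullet>\<^bsub>A\<^esub> (norm_diff A X F n \<bullet>\<^bsub>A\<^esub> norm_quot A X F n)"
      using Comp_assoc[OF norm_quot_Hom \<phi> dN] Comp_assoc[OF norm_quot_Hom norm_diff_Hom \<phi>]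
      by (simp add: \<phi>q comm)
    also have "\<dots> = nondeg_proj A X F (n - 1) \<bullet>\<^bsub>A\<^esub> chain_diff A X F n"
      using Comp_assoc[OF chain_diff_Hom norm_quot_Hom \<phi>] by (simp add: norm_diff_quot \<phi>q)
    finally show ?thesis .
  qed
  show ?thesis
    \<comment> \<open>Uniqueness is right cancellation of the projection.\<close>
    using iso dN comm square nondeg_proj_right_cancel by (intro exI[of _ \<phi>] exI[of _ dN]) auto
qed

end
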